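(* Let $0\ne P\in\hat D_1^{sym}\hat\otimes_K\tilde K$. The following statements are equivalent: 1. $P$ is a differential operator (i.e. $P\in D_1\otimes_K\tilde K=\tilde K[[x]][\partial]$) with constant highest symbol, i.e. $P=a_n\partial^n+\sum_{i=1}^n a_{n-i}\partial^{n-i}$ with $0\ne a_n\in\tilde K$ and $a_{n-i}\in \tilde K[[x]]$. 2. For every $p>1$, $P$ satisfies condition $A_p(0)$ with the extra property that all homogeneous components $P_j$ do not contain $A_i$. 3. There exists $p>1$ such that $P$ satisfies condition $A_p(0)$ with the extra property that all homogeneous components $P_j$ do not contain $A_i$.
   Context: $K$ is a field of characteristic zero, $D_1=K[[x]][\partial]$. For a formal expression $P=\sum_{k\ge 0}a_k\partial^k$, $a_k\in K[[x]]$, put $\mathbf{ord}(P)=\sup\{k-v(a_k)\}$, $v$ the $x$-adic valuation. $\hat D_1^{sym}$ is the set of those with $\mathbf{ord}(P)<\infty$; it is a ring with multiplication extending that of $D_1$. $\hat D_1^{sym}\hat\otimes_K\tilde K$ is the same ring over the extension field $\tilde K\supseteq K$. $P_m=\sum_{i-j=m}\alpha_{i,j}x^j\partial^i$ is the $m$-th homogeneous component of $P=\sum\alpha_{i,j}x^j\partial^i$, and $\sigma(P)=P_{\mathbf{ord}(P)}$. Operators: $\delta=\sum_{n\ge0}\frac{(-1)^n}{n!}x^n\partial^n$; $\int=\sum_{n\ge0}\frac{x^{n+1}}{(n+1)!}(-\partial)^n$; $D^r=\partial^r$ for $r\ge0$, $D^r=\int^{-r}$ for $r<0$; $B_j=\frac1{(j-1)!}x^{j-1}\delta\partial^{j-1}$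 for $j\ge1$; for a primitive $q$-th root of unity $\xi$, $A_i=A_{q;i}=\sum_{n\ge0}\frac{(\xi^i-1)^n}{n!}x^n\partial^n$ (so $A_0=1$). When a number $q$ is considered, $\tilde K$ is understood to contain $\xi$ (otherwise $\xi$ is adjoined to the scalars). A homogeneous canonical polynomial (HCP) from $Hcpc(q)$ is an element of the form $$H=\Big[\sum_{0\le i<q}\sum_{0\le l\le d_i}f_{l,i;r}x^lA_{q;i}\partial^l+\sum_{0<j\le N}g_{j;r}B_j\Big]D^r,\quad f_{l,i;r},g_{j;r}\in\tilde K,\ r\in\mathbb Z,$$ with $g_{j;r}=0$ for $j\le -r$ if $r<0$; this form is unique. $Sdeg_A(H)$ is the largest $l$ with some $f_{l,i;r}\ne0$ ($-\infty$ if none); $Sdeg_B(H)$ is the largest $j$ with $g_{j;r}\neq0$ ($-\infty$ if none). $H$ does not contain $A_i$ if $f_{l,i;r}=0$ for all $i>0$ and all $l$. $H$ is totally free of $B_j$ if $Sdeg_B(HD^s)=-\infty$ for all $s\in\mathbb Z$. $P$ satisfies condition $A_q(k)$ ($q,k\in\mathbb Z_{\ge 0}$, $q>1$) if: (1) $P_t$ is an HCP from $Hcpc(q)$ for all $t$; (2) $P_t$ is totally free of $B_j$ for all $t$; (3) $Sdeg_A(P_{\mathbf{ord}(P)-i})<i+k$ for all $i>0$; (4) $\sigma(P)$ does not contain $A_{q;i}$ and $Sdeg_A(\sigma(P))=k$. *)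

theory Defs
  imports
    "HOL-Computational_Algebra.Formal_Power_Series"
    "HOL-Library.Extended_Real"
    "HOL-Library.Function_Algebras"
begin

definition is_subfield :: "'a::field set \<Rightarrow> bool" where
  "is_subfield F \<longleftrightarrow> 0 \<in> F \<and> 1 \<in> F \<and>
     (\<forall>a\<in>F. \<forall>b\<in>F. a + b \<in> F \<and> a * b \<in> F) \<and> (\<forall>a\<in>F. - a \<in> F \<and> inverse a \<in> F)"

definition adjoin :: "'a::field set \<Rightarrow> 'a \<Rightarrow> 'a set" where
  "adjoin F z = \<Inter> {E. is_subfield E \<and> F \<subseteq> E \<and> z \<in> E}"

definition primitive_root :: "nat \<Rightarrow> 'a::field \<Rightarrow> bool" where
  "primitive_root q z \<longleftrightarrow> q > 0 \<and> z ^ q = 1 \<and> (\<forall>m. 0 < m \<and> m < q \<longrightarrow> z ^ m \<noteq> 1)"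


text \<open>
  The function \<open>P\<close> stands for the formal expression \<open>\<Sum>k. P k \<partial>^k\<close>, coefficients on the left.
  Zero, addition and finite sums of operators are the pointwise ones of
  \<^theory>\<open>HOL-Library.Function_Algebras\<close>; the pointwise \<open>*\<close> from there is \<^emph>\<open>not\<close> the
  product of operators, which is \<open>op_mult\<close> below.
\<close>

type_synonym 'a operator = "nat \<Rightarrow> 'a fps"

definition xval :: "'a::zero fps \<Rightarrow> ereal" where
  "xval f = (if f = 0 then \<infinity> else ereal (real (subdegree f)))"

definition op_ord :: "'a::zero operator \<Rightarrow> ereal" where
  "op_ord P = (SUP k. ereal (real k) - xval (P k))"

definition op_over :: "'a set \<Rightarrow> 'a::zero operator set" where
  "op_over F = {P. \<forall>k j. fps_nth (P k) j \<in> F}"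

definition Dsym :: "'a set \<Rightarrow> 'a::zero operator set" where
  "Dsym F = {P \<in> op_over F. op_ord P < \<infinity>}"

definition D1 :: "'a set \<Rightarrow> 'a::zero operator set" where
  "D1 F = {P \<in> op_over F. finite {k. P k \<noteq> 0}}"

text \<open>
  By the Leibniz rule, \<open>(a \<partial>^k) (b \<partial>^l) = \<Sum>j\<le>k. (k choose j) a b^(j) \<partial>^(k+l-j)\<close>; the coefficient
  at \<open>\<partial>^n\<close> collects the terms with \<open>l = n + j - k\<close>.  The outer sum is taken in the \<open>x\<close>-adic
  topology of power series; it converges as soon as \<open>op_ord P < \<infinity>\<close>, since then the valuation
  of \<open>P k\<close> is at least \<open>k - op_ord P\<close>.
\<close>

definition op_mult :: "'a::field operator \<Rightarrow> 'a operator \<Rightarrow> 'a operator"  (infixl "\<star>" 70) where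
  "P \<star> Q = (\<lambda>n. \<Sum>k. \<Sum>j | j \<le> k \<and> k \<le> n + j.
     of_nat (k choose j) * P k * (fps_deriv ^^ j) (Q (n + j - k)))"

definition op_fun :: "'a::zero fps \<Rightarrow> 'a operator" where
  "op_fun a = (\<lambda>k. if k = 0 then a else 0)"

primrec op_pow :: "'a::field operator \<Rightarrow> nat \<Rightarrow> 'a operator" where
  "op_pow P 0 = op_fun 1"
| "op_pow P (Suc n) = P \<star> op_pow P n"

definition op_scale :: "'a::field \<Rightarrow> 'a operator \<Rightarrow> 'a operator" where
  "op_scale c P = (\<lambda>k. fps_const c * P k)"

definition op_x :: "'a::field operator" where
  "op_x = op_fun fps_X"

definition op_del :: "'a::field operator" where
  "op_del = (\<lambda>k. if k = 1 then 1 else 0)"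

definition op_delta :: "'a::field_char_0 operator" where
  "op_delta = (\<lambda>n. fps_const ((-1) ^ n / fact n) * fps_X ^ n)"

definition op_int :: "'a::field_char_0 operator" where
  "op_int = (\<lambda>n. fps_const ((-1) ^ n / fact (n + 1)) * fps_X ^ (n + 1))"

definition op_D :: "int \<Rightarrow> 'a::field_char_0 operator" where
  "op_D r = (if r \<ge> 0 then op_pow op_del (nat r) else op_pow op_int (nat (- r)))"

definition op_B :: "nat \<Rightarrow> 'a::field_char_0 operator" where
  "op_B j = op_scale (1 / fact (j - 1))
     (op_pow op_x (j - 1) \<star> op_delta \<star> op_pow op_del (j - 1))"

text \<open>Here \<open>z\<close> is the primitive \<open>q\<close>-th root of unity, so \<open>op_A z i\<close> is \<open>A_{q;i}\<close>.\<close>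

definition op_A :: "'a::field_char_0 \<Rightarrow> nat \<Rightarrow> 'a operator" where
  "op_A z i = (\<lambda>n. fps_const ((z ^ i - 1) ^ n / fact n) * fps_X ^ n)"


text \<open>
  \<open>hcomp P m\<close> keeps the monomials \<open>x^j \<partial>^i\<close> of \<open>P\<close> with \<open>i - j = m\<close>.
  The order of a nonzero element of \<open>Dsym\<close> is an integer; \<open>int_ord\<close> is that integer.
\<close>

definition hcomp :: "'a::field operator \<Rightarrow> int \<Rightarrow> 'a operator" where
  "hcomp P m = (\<lambda>i. if int i \<ge> m
     then fps_const (fps_nth (P i) (nat (int i - m))) * fps_X ^ nat (int i - m) else 0)"

definition int_ord :: "'a::zero operator \<Rightarrow> int" where
  "int_ord P = \<lfloor>real_of_ereal (op_ord P)\<rfloor>"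

definition symb :: "'a::field operator \<Rightarrow> 'a operator" where
  "symb P = hcomp P (int_ord P)"


text \<open>
  \<open>hcp_form F q z r f g H\<close> states that \<open>H\<close> is the homogeneous canonical polynomial with exponent
  \<open>r\<close> and coefficients \<open>f l i\<close>, \<open>g j\<close> in the field \<open>F\<close>.  The coefficient functions are required
  to vanish outside the ranges of summation, so that they are determined by the form.
\<close>

definition hcp_form ::
  "'a set \<Rightarrow> nat \<Rightarrow> 'a \<Rightarrow> int \<Rightarrow> (nat \<Rightarrow> nat \<Rightarrow> 'a) \<Rightarrow> (nat \<Rightarrow> 'a) \<Rightarrow> 'a::field_char_0 operator \<Rightarrow> bool"
  where
  "hcp_form F q z r f g H \<longleftrightarrow>
     (\<forall>l i. f l i \<in> F) \<and> (\<forall>j. g j \<in> F) \<and>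
     (r < 0 \<longrightarrow> (\<forall>j. int j \<le> - r \<longrightarrow> g j = 0)) \<and>
     (\<exists>d N. (\<forall>l i. \<not> (i < q \<and> l \<le> d i) \<longrightarrow> f l i = 0) \<and> (\<forall>j. \<not> (0 < j \<and> j \<le> N) \<longrightarrow> g j = 0) \<and>
        H = ((\<Sum>i<q. \<Sum>l\<le>d i. op_scale (f l i) (op_pow op_x l \<star> op_A z i \<star> op_pow op_del l))
             + (\<Sum>j=1..N. op_scale (g j) (op_B j))) \<star> op_D r)"

definition Hcpc :: "'a set \<Rightarrow> nat \<Rightarrow> 'a \<Rightarrow> 'a::field_char_0 operator set" where
  "Hcpc F q z = {H. \<exists>r f g. hcp_form F q z r f g H}"

text \<open>
  In \<^typ>\<open>ereal\<close> the supremum of the empty set is \<open>-\<infinity>\<close>.  As the canonical form is unique and has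
  finitely many coefficients, the suprema below are the maxima over its nonzero coefficients.
\<close>

definition Sdeg_A :: "'a set \<Rightarrow> nat \<Rightarrow> 'a \<Rightarrow> 'a::field_char_0 operator \<Rightarrow> ereal" where
  "Sdeg_A F q z H = Sup {ereal (real l) | l. \<exists>r f g i. hcp_form F q z r f g H \<and> f l i \<noteq> 0}"

definition Sdeg_B :: "'a set \<Rightarrow> nat \<Rightarrow> 'a \<Rightarrow> 'a::field_char_0 operator \<Rightarrow> ereal" where
  "Sdeg_B F q z H = Sup {ereal (real j) | j. \<exists>r f g. hcp_form F q z r f g H \<and> g j \<noteq> 0}"

definition contains_A :: "'a set \<Rightarrow> nat \<Rightarrow> 'a \<Rightarrow> 'a::field_char_0 operator \<Rightarrow> bool" where
  "contains_A F q z H \<longleftrightarrow> (\<exists>r f g i l. hcp_form F q z r f g H \<and> i > 0 \<and> f l i \<noteq> 0)"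

definition totally_free_of_B :: "'a set \<Rightarrow> nat \<Rightarrow> 'a \<Rightarrow> 'a::field_char_0 operator \<Rightarrow> bool" where
  "totally_free_of_B F q z H \<longleftrightarrow> (\<forall>s. Sdeg_B F q z (H \<star> op_D s) = -\<infinity>)"

definition condition_A :: "'a set \<Rightarrow> nat \<Rightarrow> 'a \<Rightarrow> nat \<Rightarrow> 'a::field_char_0 operator \<Rightarrow> bool" where
  "condition_A F q z k P \<longleftrightarrow>
     (\<forall>t. hcomp P t \<in> Hcpc F q z) \<and>
     (\<forall>t. totally_free_of_B F q z (hcomp P t)) \<and>
     (\<forall>i::nat. i > 0 \<longrightarrow> Sdeg_A F q z (hcomp P (int_ord P - int i)) < ereal (real (i + k))) \<and>
     \<not> contains_A F q z (symb P) \<and> Sdeg_A F q z (symb P) = ereal (real k)"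

definition has_constant_highest_symbol :: "'a set \<Rightarrow> 'a::zero operator \<Rightarrow> bool" where
  "has_constant_highest_symbol F P \<longleftrightarrow>
     (\<exists>n c. c \<in> F \<and> c \<noteq> 0 \<and> P n = fps_const c \<and> (\<forall>k>n. P k = 0))"

text \<open>
  \<open>z\<close> chooses a primitive root of unity for every \<open>p\<close>; the condition \<open>A_p(0)\<close> is read over the
  field of scalars \<open>F(z p)\<close>, which is \<open>F\<close> itself if \<open>F\<close> contains \<open>z p\<close>.
\<close>

definition condition_A0_without_A :: "'a set \<Rightarrow> (nat \<Rightarrow> 'a) \<Rightarrow> nat \<Rightarrow> 'a::field_char_0 operator \<Rightarrow> bool" where
  "condition_A0_without_A F z p P \<longleftrightarrow>
     condition_A (adjoin F (z p)) p (z p) 0 P \<and>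
     (\<forall>j. \<not> contains_A (adjoin F (z p)) p (z p) (hcomp P j))"

end

theory Submission
  imports Defs "HOL-Computational_Algebra.Polynomial"
begin

text \<open>
  An operator is determined by its values on the monomials \<open>x\<^sup>m\<close>, and one that is homogeneous of
  degree \<open>r\<close> sends \<open>x\<^sup>m\<close> to \<open>e(m) x\<^sup>m\<^sup>-\<^sup>r\<close>; products of homogeneous operators become products
  of such functions \<open>e\<close>.  An HCP with exponent \<open>r\<close> has \<open>e(m) = h(m - r) e'(m)\<close>, where \<open>e'\<close> belongs
  to \<open>D\<^sup>r\<close> and \<open>h\<close> is a quasi-polynomial of period \<open>q\<close> (the part with the \<open>A\<^sub>i\<close>), changed at
  finitely many places by the \<open>B\<^sub>j\<close>; this makes the canonical form unique.

  If no \<open>A\<^sub>i\<close> with \<open>i > 0\<close> occurs, then total freedom of \<open>B\<^sub>j\<close> says exactly that the component of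
  degree \<open>t < 0\<close> has the form \<open>\<Sum>\<^sub>l f\<^sub>l x\<^sup>l \<partial>\<^sup>l\<^sup>+\<^sup>t\<close> with \<open>f\<^sub>l = 0\<close> for \<open>l < -t\<close>, hence is a
  differential operator.  With \<open>l < i\<close> for the component of degree \<open>n - i\<close>, where \<open>n\<close> is the order,
  all components except the symbol \<open>f\<^sub>0 \<partial>\<^sup>n\<close> have order less than \<open>n\<close> in \<open>\<partial>\<close>.
\<close>

section \<open>Action on monomials\<close>

definition falling :: "nat \<Rightarrow> nat \<Rightarrow> 'a::field_char_0" where
  "falling m l = (\<Prod>i<l. of_nat m - of_nat i)"

lemma falling_0 [simp]: "falling m 0 = 1"
  by (simp add: falling_def)

lemma falling_Suc: "falling m (Suc l) = falling m l * (of_nat m - of_nat l)"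
  by (simp add: falling_def)

lemma falling_eq_0_iff: "falling m l = 0 \<longleftrightarrow> m < l"
  by (auto simp: falling_def)

lemma falling_eq_fact_div: "l \<le> m \<Longrightarrow> falling m l = fact m / fact (m - l)"
proof (induction l)
  case (Suc l)
  then have "m - l = Suc (m - Suc l)"
    by simp
  with Suc show ?case
    by (simp add: falling_Suc of_nat_diff divide_simps mult.assoc)
qed simp

lemma falling_self: "falling m m = fact m"
  by (simp add: falling_eq_fact_div)

lemma falling_eq_fact_binomial: "falling m l = fact l * of_nat (m choose l)"
proof (cases "l \<le> m")
  case True
  then show ?thesis
    by (simp add: falling_eq_fact_div binomial_fact)
next
  case False
  then show ?thesis
    by (simp add: falling_eq_0_iff [THEN iffD2] binomial_eq_0)
qed

lemma higher_deriv_sum: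
  "(fps_deriv ^^ k) (\<Sum>i\<in>A. f i) = (\<Sum>i\<in>A. (fps_deriv ^^ k) (f i))"
  by (induction k) (simp_all add: fps_deriv_sum)

lemma higher_deriv_const_mult:
  fixes f :: "'a::comm_ring_1 fps"
  shows "(fps_deriv ^^ k) (fps_const c * f) = fps_const c * (fps_deriv ^^ k) f"
  by (induction k) simp_all

lemma higher_deriv_mult:
  fixes a b :: "'a::comm_ring_1 fps"
  shows "(fps_deriv ^^ k) (a * b) =
    (\<Sum>j\<le>k. of_nat (k choose j) * (fps_deriv ^^ j) a * (fps_deriv ^^ (k - j)) b)"
proof (induction k)
  case (Suc k)
  let ?a = "\<lambda>j. (fps_deriv ^^ j) a" and ?b = "\<lambda>j. (fps_deriv ^^ j) b"
  have "(fps_deriv ^^ Suc k) (a * b) =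
      (\<Sum>j\<le>k. of_nat (k choose j) * ?a j * ?b (Suc k - j)) +
      (\<Sum>j\<le>k. of_nat (k choose j) * ?a (Suc j) * ?b (k - j))"
    by (simp add: Suc fps_deriv_sum sum.distrib [symmetric] Suc_diff_le algebra_simps)
  \<comment> \<open>Since \<open>k choose Suc k\<close> is 0, the range extends to
    \<open>Suc k\<close>; splitting off \<open>j = 0\<close> then aligns both sums for Pascal's
    rule.\<close>
  also have "(\<Sum>j\<le>k. of_nat (k choose j) * ?a j * ?b (Suc k - j)) =
      ?a 0 * ?b (Suc k) + (\<Sum>j\<le>k. of_nat (k choose Suc j) * ?a (Suc j) * ?b (k - j))"
  proof -
    have "(\<Sum>j\<le>k. of_nat (k choose j) * ?a j * ?b (Suc k - j)) =
        (\<Sum>j\<le>Suc k. of_nat (k choose j) * ?a j * ?b (Suc k - j))"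
      by (simp add: binomial_eq_0)
    then show ?thesis
      by (simp only: sum.atMost_Suc_shift) simp
  qed
  also have "?a 0 * ?b (Suc k) + (\<Sum>j\<le>k. of_nat (k choose Suc j) * ?a (Suc j) * ?b (k - j)) +
      (\<Sum>j\<le>k. of_nat (k choose j) * ?a (Suc j) * ?b (k - j)) =
      (\<Sum>j\<le>Suc k. of_nat (Suc k choose j) * ?a j * ?b (Suc k - j))"
    by (subst sum.atMost_Suc_shift) (simp add: algebra_simps sum.distrib del: funpow.simps)
  finally show ?case .
qed simp

lemma higher_deriv_X_power:
  "(fps_deriv ^^ k) (fps_X ^ m) = fps_const (falling m k) * fps_X ^ (m - k)"
proof (induction k)
  case (Suc k)
  have "(fps_deriv ^^ Suc k) (fps_X ^ m :: 'a fps) =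
      fps_const (falling m k * of_nat (m - k)) * fps_X ^ (m - Suc k)"
    by (simp add: Suc fps_deriv_power fps_of_nat [symmetric] flip: fps_const_mult)
  moreover have "falling m k * of_nat (m - k) = (falling m (Suc k) :: 'a)"
    by (cases "k \<le> m") (simp_all add: falling_Suc of_nat_diff falling_eq_0_iff [THEN iffD2])
  ultimately show ?case
    by simp
qed simp

text \<open>The value \<open>P(x^m)\<close>. Stopping at \<open>k = m\<close> loses nothing, as
  higher derivatives kill \<open>x^m\<close>, so no convergence question arises.\<close>

definition act :: "'a::field_char_0 operator \<Rightarrow> nat \<Rightarrow> 'a fps" where
  "act P m = (\<Sum>k\<le>m. P k * (fps_deriv ^^ k) (fps_X ^ m))"

lemma act_eq: "act P m = (\<Sum>k\<le>m. fps_const (falling m k) * P k * fps_X ^ (m - k))"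
  by (simp add: act_def higher_deriv_X_power mult_ac)

lemma act_eq_top:
  "act P m = (\<Sum>k<m. fps_const (falling m k) * P k * fps_X ^ (m - k)) + fps_const (fact m) * P m"
  by (simp add: act_eq lessThan_Suc_atMost [symmetric] falling_self)

text \<open>The values form a triangular system: \<open>P(x^m)\<close> involves \<open>P k\<close>
  for \<open>k < m\<close> and the term \<open>m! P m\<close>, and \<open>m!\<close> is
  invertible.\<close>

lemma act_inject:
  assumes "\<And>m. act P m = act Q m"
  shows "P = Q"
proof
  fix m
  show "P m = Q m"
  proof (induction m rule: less_induct)
    case (less m)
    then have "fps_const (fact m) * P m = fps_const (fact m) * Q m"
      using assms [of m] by (simp add: act_eq_top)
    then show ?case
      by simp
  qed
qed

text \<open>The condition for \<open>m < r\<close> is stated separately because \<open>nat\<close>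
  turns a negative exponent \<open>m - r\<close> into 0 and would admit a nonzero constant as
  value.\<close>

definition acts :: "'a::field_char_0 operator \<Rightarrow> int \<Rightarrow> (nat \<Rightarrow> 'a) \<Rightarrow> bool" where
  "acts P r e \<longleftrightarrow> (\<forall>m. (int m < r \<longrightarrow> e m = 0) \<and>
     act P m = fps_const (e m) * fps_X ^ nat (int m - r))"

lemma acts_cong:
  assumes "acts P r e" "\<And>m. e m = e' m" "r = r'"
  shows "acts P r' e'"
proof -
  have "e = e'" using assms(2) by auto
  then show ?thesis using assms by simp
qed

lemma acts_inject: "acts P r e \<Longrightarrow> acts Q r e \<Longrightarrow> P = Q"
  by (rule act_inject) (simp add: acts_def)

lemma acts_unique:
  assumes "acts P r e" "acts P r e'"
  shows "e = e'"
proof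
  fix m
  have "fps_const (e m) * fps_X ^ nat (int m - r) = fps_const (e' m) * fps_X ^ nat (int m - r)"
    using assms by (simp add: acts_def)
  then have "fps_const (e m) = fps_const (e' m)"
    by simp
  then show "e m = e' m"
    by (metis fps_nth_fps_const)
qed

lemma acts_zero: "acts 0 r (\<lambda>_. 0)"
  by (simp add: acts_def act_def)

text \<open>Where the multiplier is nonzero, both exponents \<open>m - r\<close> and
  \<open>m - r'\<close> are nonnegative, so subdegrees can be compared. The operator 0 has every
  degree.\<close>

lemma acts_degree_unique:
  assumes "acts P r e" "acts P r' e'" "P \<noteq> 0"
  shows "r = r'"
proof -
  have "e \<noteq> (\<lambda>_. 0)"
    using assms(1,3) acts_inject acts_zero by blast
  then obtain m where m: "e m \<noteq> 0"
    by auto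
  have eq: "fps_const (e m) * fps_X ^ nat (int m - r) = fps_const (e' m) * fps_X ^ nat (int m - r')"
    using assms(1,2) by (simp add: acts_def)
  have m': "e' m \<noteq> 0"
  proof
    assume "e' m = 0"
    with eq have "fps_const (e m) * fps_X ^ nat (int m - r) = 0"
      by simp
    with m show False
      by simp
  qed
  have "subdegree (fps_const (e m) * fps_X ^ nat (int m - r)) =
      subdegree (fps_const (e' m) * fps_X ^ nat (int m - r'))"
    using eq by simp
  then have "nat (int m - r) = nat (int m - r')"
    using m m' by simp
  moreover have "r \<le> int m" "r' \<le> int m"
    using assms(1,2) m m' unfolding acts_def by (meson not_le)+
  ultimately show ?thesis
    by simp
qed

section \<open>Linear combinations and coefficients of homogeneous operators\<close>

lemma act_add: "act (P + Q) m = act P m + act Q m"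
  by (simp add: act_def algebra_simps sum.distrib)

lemma acts_add: "acts P r e \<Longrightarrow> acts Q r e' \<Longrightarrow> acts (P + Q) r (\<lambda>m. e m + e' m)"
  by (simp add: acts_def act_add algebra_simps flip: fps_const_add)

lemma acts_scale: "acts P r e \<Longrightarrow> acts (op_scale c P) r (\<lambda>m. c * e m)"
  by (simp add: acts_def act_def op_scale_def mult.assoc sum_distrib_left [symmetric]
      flip: fps_const_mult)

lemma acts_sum:
  assumes "\<And>i. i \<in> A \<Longrightarrow> acts (P i) r (e i)"
  shows "acts (\<Sum>i\<in>A. P i) r (\<lambda>m. \<Sum>i\<in>A. e i m)"
  using assms
proof (induction A rule: infinite_finite_induct)
  case (insert x A)
  then show ?case
    using acts_add [of "P x" r "e x" "sum P A"] by (simp add: plus_fun_def)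
qed (simp_all add: acts_zero)

lemma fps_const_sum: "fps_const (\<Sum>i\<in>A. f i) = (\<Sum>i\<in>A. fps_const (f i))"
  by (induction A rule: infinite_finite_induct) (simp_all flip: fps_const_add)

text \<open>All summands share the \<open>x\<close>-degree \<open>(i - r) + (k - i) = k - r\<close>.
  The index set is left open to cover both the whole sum \<open>act P k\<close> and its part below
  \<open>k\<close>.\<close>

lemma sum_homogeneous:
  assumes "\<And>i. i \<in> A \<Longrightarrow> i \<le> k"
    and "\<And>i. i \<in> A \<Longrightarrow>
      P i = (if r \<le> int i then fps_const (c i) * fps_X ^ nat (int i - r) else 0)"
  shows "(\<Sum>i\<in>A. fps_const (falling k i) * P i * fps_X ^ (k - i)) =
    fps_const (\<Sum>i\<in>A. if r \<le> int i then falling k i * c i else 0) * fps_X ^ nat (int k - r)"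
proof -
  have "fps_const (falling k i) * P i * fps_X ^ (k - i) =
      fps_const (if r \<le> int i then falling k i * c i else 0) * fps_X ^ nat (int k - r)"
    if "i \<in> A" for i
  proof (cases "r \<le> int i")
    case True
    then have "nat (int k - r) = nat (int i - r) + (k - i)"
      using assms(1) [OF that] by simp
    then have "fps_X ^ nat (int k - r) = fps_X ^ nat (int i - r) * (fps_X ^ (k - i) :: 'a fps)"
      by (simp only: power_add)
    then show ?thesis
      using True that by (simp add: assms(2) mult_ac flip: fps_const_mult)
  qed (simp add: assms(2) that)
  then show ?thesis
    by (simp add: sum_distrib_right fps_const_sum flip: fps_const_mult)
qed

text \<open>The triangular system is solved step by step: once the \<open>P i\<close> with
  \<open>i < k\<close> are monomials of the right degree, the value at \<open>x^k\<close> forces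
  this for \<open>P k\<close>.\<close>

lemma acts_monomial:
  assumes "acts P r e"
  shows "\<exists>c. P k = (if r \<le> int k then fps_const c * fps_X ^ nat (int k - r) else 0)"
proof (induction k rule: less_induct)
  case (less k)
  then obtain c where
    c: "\<And>i. i < k \<Longrightarrow> P i = (if r \<le> int i then fps_const (c i) * fps_X ^ nat (int i - r) else 0)"
    by metis
  have low: "(\<Sum>i<k. fps_const (falling k i) * P i * fps_X ^ (k - i)) =
      fps_const (\<Sum>i<k. if r \<le> int i then falling k i * c i else 0) * fps_X ^ nat (int k - r)"
    by (rule sum_homogeneous) (simp_all add: c)
  define S where "S = (\<Sum>i<k. if r \<le> int i then falling k i * c i else 0)"
  \<comment> \<open>\<open>b\<close> solves the \<open>k\<close>-th equation
    \<open>e k = S + k! b\<close>.\<close>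
  define b where "b = (e k - S) / fact k"
  have b: "fact k * b = e k - S"
    by (simp add: b_def)
  have "fps_const (fact k) * P k = fps_const (fact k * b) * fps_X ^ nat (int k - r)"
    using assms low act_eq_top [of P k]
    unfolding b acts_def S_def [symmetric]
    by (simp add: algebra_simps flip: fps_const_sub)
  then have "fps_const (fact k) * P k = fps_const (fact k) * (fps_const b * fps_X ^ nat (int k - r))"
    by (simp add: mult_ac flip: fps_const_mult)
  then have Pk: "P k = fps_const b * fps_X ^ nat (int k - r)"
    by simp
  moreover have "b = 0" if "int k < r"
    using that assms by (auto simp: b_def S_def acts_def intro: sum.neutral)
  ultimately show ?case
    by (intro exI [of _ b]) auto
qed

section \<open>Products of homogeneous operators\<close>

lemma op_mult_finite_sum:
  assumes "acts Q s e" "nat (int n - s) \<le> M"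
  shows "(P \<star> Q) n = (\<Sum>k\<le>M. \<Sum>j | j \<le> k \<and> k \<le> n + j.
     of_nat (k choose j) * P k * (fps_deriv ^^ j) (Q (n + j - k)))"
  unfolding op_mult_def
proof (rule suminf_finite)
  fix k
  assume k: "k \<notin> {..M}"
  \<comment> \<open>\<open>Q l\<close> is a multiple of \<open>x^(l - s)\<close>, so this is a
    \<open>j\<close>-th derivative of a power with exponent \<open>n + j - k - s\<close>, which is
    below \<open>j\<close> once \<open>k > n - s\<close>. The series is therefore a finite
    sum.\<close>
  have "(fps_deriv ^^ j) (Q (n + j - k)) = 0" if "j \<le> k" "k \<le> n + j" for j
  proof -
    obtain c where c: "Q (n + j - k) = (if s \<le> int (n + j - k)
        then fps_const c * fps_X ^ nat (int (n + j - k) - s) else 0)"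
      using acts_monomial [OF assms(1)] by blast
    show ?thesis
    proof (cases "s \<le> int (n + j - k)")
      case True
      then have "nat (int (n + j - k) - s) < j"
        using that k assms(2) by auto
      then have "falling (nat (int (n + j - k) - s)) j = (0 :: 'a)"
        by (simp add: falling_eq_0_iff)
      with True show ?thesis
        by (simp add: c higher_deriv_const_mult higher_deriv_X_power)
    next
      case False
      have "(fps_deriv ^^ j) (0 :: 'a fps) = 0"
        by (induction j) simp_all
      with False show ?thesis
        by (simp add: c)
    qed
  qed
  then show "(\<Sum>j | j \<le> k \<and> k \<le> n + j.
      of_nat (k choose j) * P k * (fps_deriv ^^ j) (Q (n + j - k))) = 0"
    by (intro sum.neutral) auto
qed simp

text \<open>Expanding the composition \<open>P(Q(x^m))\<close> by the Leibniz rule yields the double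
  sum that defines \<open>\<star>\<close>.\<close>

lemma act_op_mult:
  assumes "acts Q s e"
  shows "act (P \<star> Q) m = fps_const (e m) * act P (nat (int m - s))"
proof -
  \<comment> \<open>\<open>M\<close> is the exponent of \<open>Q(x^m)\<close>; it also bounds the
    outer index for all \<open>n \<le> m\<close> at once, so the sums can be interchanged.\<close>
  define M where "M = nat (int m - s)"
  let ?D = "\<lambda>k. fps_deriv ^^ k"
  let ?X = "fps_X ^ m :: 'a fps"
  \<comment> \<open>Substitution \<open>n = l + (k - j)\<close>: the additional terms on the right,
    with \<open>n > m\<close>, contain an \<open>n\<close>-th derivative of \<open>x^m\<close> and
    vanish.\<close>
  have shift: "(\<Sum>n | n \<le> m \<and> k \<le> n + j. ?D j (Q (n + j - k)) * ?D n ?X) =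
      (\<Sum>l\<le>m. ?D j (Q l) * ?D (k - j) (?D l ?X))" if "j \<le> k" for j k
  proof -
    have "?D j (Q l) * ?D (k - j) (?D l ?X) = 0" if "l \<le> m" "\<not> l + (k - j) \<le> m" for l
    proof -
      have "?D (k - j) (?D l ?X) = ?D ((k - j) + l) ?X"
        by (simp add: funpow_add)
      also have "\<dots> = 0"
        using that by (simp add: higher_deriv_X_power falling_eq_0_iff)
      finally show ?thesis
        by simp
    qed
    then have "(\<Sum>l\<le>m. ?D j (Q l) * ?D (k - j) (?D l ?X)) =
        (\<Sum>l | l + (k - j) \<le> m. ?D j (Q l) * ?D (k - j) (?D l ?X))"
      by (intro sum.mono_neutral_right) auto
    also have "\<dots> = (\<Sum>n | n \<le> m \<and> k \<le> n + j. ?D j (Q (n + j - k)) * ?D n ?X)"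
    proof (rule sum.reindex_bij_witness [where i = "\<lambda>n. n + j - k" and j = "\<lambda>l. l + (k - j)"])
      fix l
      assume "l \<in> {l. l + (k - j) \<le> m}"
      have "?D (l + (k - j)) ?X = ?D (k - j) (?D l ?X)"
        by (simp add: funpow_add add.commute [of l])
      then show "?D j (Q (l + (k - j) + j - k)) * ?D (l + (k - j)) ?X =
          ?D j (Q l) * ?D (k - j) (?D l ?X)"
        using that by simp
    qed (use that in auto)
    finally show ?thesis ..
  qed
  have "act (P \<star> Q) m = (\<Sum>n\<le>m. \<Sum>k\<le>M. \<Sum>j | j \<le> k \<and> k \<le> n + j.
      of_nat (k choose j) * P k * (?D j (Q (n + j - k)) * ?D n ?X))"
    unfolding act_def
  proof (intro sum.cong refl)
    fix n
    assume "n \<in> {..m}"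
    then have "nat (int n - s) \<le> M"
      by (simp add: M_def)
    from op_mult_finite_sum [OF assms this, of P]
    show "(P \<star> Q) n * ?D n ?X = (\<Sum>k\<le>M. \<Sum>j | j \<le> k \<and> k \<le> n + j.
      of_nat (k choose j) * P k * (?D j (Q (n + j - k)) * ?D n ?X))"
      by (simp add: sum_distrib_right mult.assoc)
  qed
  also have "\<dots> = (\<Sum>k\<le>M. \<Sum>n\<le>m. \<Sum>j | j \<le> k \<and> k \<le> n + j.
      of_nat (k choose j) * P k * (?D j (Q (n + j - k)) * ?D n ?X))"
    by (rule sum.swap)
  also have "\<dots> = (\<Sum>k\<le>M. P k * ?D k (act Q m))"
  proof (intro sum.cong refl)
    fix k
    have "(\<Sum>n\<le>m. \<Sum>j | j \<le> k \<and> k \<le> n + j.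
        of_nat (k choose j) * P k * (?D j (Q (n + j - k)) * ?D n ?X)) =
      (\<Sum>n\<in>{..m}. \<Sum>j\<in>{j \<in> {..k}. k \<le> n + j}.
        of_nat (k choose j) * P k * (?D j (Q (n + j - k)) * ?D n ?X))"
      by (intro sum.cong refl) auto
    also have "\<dots> = (\<Sum>j\<le>k. \<Sum>n\<in>{n \<in> {..m}. k \<le> n + j}.
        of_nat (k choose j) * P k * (?D j (Q (n + j - k)) * ?D n ?X))"
      by (rule sum.swap_restrict) simp_all
    also have "\<dots> = (\<Sum>j\<le>k. \<Sum>l\<le>m. of_nat (k choose j) * P k *
        (?D j (Q l) * ?D (k - j) (?D l ?X)))"
    proof (rule sum.cong [OF refl])
      fix j
      assume "j \<in> {..k}"
      then have "j \<le> k"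
        by simp
      from shift [OF this]
      show "(\<Sum>n | n \<in> {..m} \<and> k \<le> n + j.
          of_nat (k choose j) * P k * (?D j (Q (n + j - k)) * ?D n ?X)) =
        (\<Sum>l\<le>m. of_nat (k choose j) * P k * (?D j (Q l) * ?D (k - j) (?D l ?X)))"
        by (simp flip: sum_distrib_left)
    qed
    also have "\<dots> = (\<Sum>l\<le>m. \<Sum>j\<le>k. of_nat (k choose j) * P k *
        (?D j (Q l) * ?D (k - j) (?D l ?X)))"
      by (rule sum.swap)
    also have "\<dots> = P k * ?D k (act Q m)"
      by (simp add: act_def higher_deriv_sum higher_deriv_mult sum_distrib_left mult_ac)
    finally show "(\<Sum>n\<le>m. \<Sum>j | j \<le> k \<and> k \<le> n + j.
        of_nat (k choose j) * P k * (?D j (Q (n + j - k)) * ?D n ?X)) = P k * ?D k (act Q m)" .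
  qed
  also have "\<dots> = fps_const (e m) * act P M"
    using assms by (simp add: acts_def higher_deriv_const_mult act_def [of P] M_def
        sum_distrib_left mult_ac)
  finally show ?thesis
    by (simp add: M_def)
qed

lemma acts_op_mult:
  assumes "acts P r e" "acts Q s e'"
  shows "acts (P \<star> Q) (r + s) (\<lambda>m. e (nat (int m - s)) * e' m)"
  unfolding acts_def
proof (intro allI conjI impI)
  fix m
  assume m: "int m < r + s"
  show "e (nat (int m - s)) * e' m = 0"
  proof (cases "int m < s")
    case True
    then show ?thesis
      using assms(2) by (simp add: acts_def)
  next
    case False
    then have "int (nat (int m - s)) < r"
      using m by simp
    then show ?thesis
      using assms(1) by (simp add: acts_def)
  qed
next
  fix m
  show "act (P \<star> Q) m =
      fps_const (e (nat (int m - s)) * e' m) * fps_X ^ nat (int m - (r + s))"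
  proof (cases "int m < s")
    case True
    then show ?thesis
      using assms(2) act_op_mult [OF assms(2), of P m] by (simp add: acts_def)
  next
    case False
    then have "nat (int (nat (int m - s)) - r) = nat (int m - (r + s))"
      by simp
    then show ?thesis
      using assms(1) by (simp add: act_op_mult [OF assms(2)] acts_def mult_ac)
  qed
qed

section \<open>Multipliers of the basic operators\<close>

lemma acts_op_fun: "acts (op_fun 1) 0 (\<lambda>_. 1)"
proof -
  have "act (op_fun 1) m = (fps_X ^ m :: 'a fps)" for m
    by (simp add: act_def op_fun_def sum.atMost_shift)
  then show ?thesis
    by (simp add: acts_def)
qed

lemma acts_op_x: "acts op_x (-1) (\<lambda>_. 1)"
proof -
  have "act op_x m = (fps_X ^ Suc m :: 'a fps)" for m
    by (simp add: act_def op_x_def op_fun_def sum.atMost_shift)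
  then show ?thesis
    by (simp add: acts_def nat_add_distrib)
qed

lemma acts_op_del: "acts op_del 1 of_nat"
proof -
  have "act op_del m = (fps_const (of_nat m) * fps_X ^ (m - 1) :: 'a fps)" for m
  proof (cases m)
    case (Suc n)
    have "act op_del m = (\<Sum>k\<le>m. if k = 1 then fps_deriv (fps_X ^ m :: 'a fps) else 0)"
      unfolding act_def by (intro sum.cong refl) (simp add: op_del_def)
    also have "\<dots> = fps_deriv (fps_X ^ m)"
      by (simp add: Suc del: power_Suc)
    finally have "act op_del m = fps_deriv (fps_X ^ m :: 'a fps)" .
    then show ?thesis
      by (simp add: fps_deriv_power fps_of_nat del: power_Suc of_nat_Suc)
  qed (simp add: act_def op_del_def)
  moreover have "nat (int m - 1) = m - 1" for m
    by arith
  ultimately show ?thesis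
    by (simp add: acts_def)
qed

lemma acts_op_pow_x: "acts (op_pow op_x l) (- int l) (\<lambda>_. 1)"
proof (induction l)
  case 0
  show ?case
    by (simp add: acts_op_fun)
next
  case (Suc l)
  show ?case
    using acts_op_mult [OF acts_op_x Suc] by (simp add: algebra_simps)
qed

text \<open>The multiplier of \<open>D^r\<close>: a falling factorial for \<open>r \<ge> 0\<close>,
  and \<open>1/((m+1)...(m+s))\<close>, from \<open>s\<close>-fold integration, for
  \<open>r = -s\<close>.\<close>

definition ratio :: "int \<Rightarrow> nat \<Rightarrow> 'a::field_char_0" where
  "ratio r m = (if r \<le> int m then fact m / fact (nat (int m - r)) else 0)"

lemma ratio_nonneg: "ratio (int l) m = falling m l"
  by (auto simp: ratio_def falling_eq_fact_div falling_eq_0_iff nat_diff_distrib)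

lemma acts_op_pow_del: "acts (op_pow op_del l) (int l) (\<lambda>m. falling m l)"
proof (induction l)
  case 0
  show ?case
    by (simp add: acts_op_fun)
next
  case (Suc l)
  show ?case
    unfolding op_pow.simps
  proof (rule acts_cong [OF acts_op_mult [OF acts_op_del Suc]])
    fix m
    show "of_nat (nat (int m - int l)) * falling m l = (falling m (Suc l) :: 'a)"
      by (cases "l \<le> m") (simp_all add: falling_Suc of_nat_diff falling_eq_0_iff [THEN iffD2] nat_diff_distrib)
  qed simp
qed

text \<open>Absorption turns the summands into signed binomial coefficients of row
  \<open>m + 1\<close>, whose full alternating sum is 0; only the missing first one contributes.
  This makes \<open>op_int\<close> integration from 0.\<close>

lemma sum_falling_neg_one_power: 
  fixes m :: nat
  shows "(\<Sum>k\<le>m. falling m k * ((-1) ^ k / fact (k + 1))) = (1 / of_nat (Suc m) :: 'a::field_char_0)"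
proof -
  have t: "falling m k * ((-1) ^ k / fact (k + 1)) =
      - (of_nat (Suc m choose Suc k) * (-1) ^ Suc k) / (of_nat (Suc m) :: 'a)" if "k \<le> m" for k
  proof -
    have "of_nat (Suc k * (Suc m choose Suc k)) = (of_nat (Suc m * (m choose k)) :: 'a)"
      by (simp only: Suc_times_binomial_eq mult.commute)
    then show ?thesis
      unfolding of_nat_mult
      by (simp add: falling_eq_fact_binomial divide_simps mult_ac del: of_nat_Suc binomial_Suc_Suc)
  qed
  have "(\<Sum>k\<le>Suc m. of_nat (Suc m choose k) * (-1) ^ k) = (0 :: 'a)"
    using binomial_ring [of "-1 :: 'a" 1 "Suc m"] by (simp add: mult_ac)
  then have "(\<Sum>k\<le>m. of_nat (Suc m choose Suc k) * (-1) ^ Suc k) = (-1 :: 'a)"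
    by (subst (asm) sum.atMost_Suc_shift) (simp add: eq_neg_iff_add_eq_0 add.commute)
  moreover have "(\<Sum>k\<le>m. falling m k * ((-1) ^ k / fact (k + 1))) =
      - (\<Sum>k\<le>m. of_nat (Suc m choose Suc k) * (-1) ^ Suc k) / (of_nat (Suc m) :: 'a)"
    unfolding sum_negf [symmetric] sum_divide_distrib by (intro sum.cong refl t) simp
  ultimately show ?thesis
    by simp
qed

lemma act_dilation:
  assumes "\<And>k. P k = fps_const (c k) * fps_X ^ (k + d)"
  shows "act P m = fps_const (\<Sum>k\<le>m. falling m k * c k) * fps_X ^ (m + d)"
proof -
  have "act P m = fps_const (\<Sum>k\<le>m. if - int d \<le> int k then falling m k * c k else 0) *
      fps_X ^ nat (int m - - int d)"
    unfolding act_eq by (rule sum_homogeneous) (simp_all add: assms nat_add_distrib)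
  then show ?thesis
    by (simp add: nat_add_distrib)
qed

lemma acts_op_int: "acts op_int (-1) (\<lambda>m. 1 / of_nat (Suc m))"
proof -
  have "act op_int m = fps_const (1 / of_nat (Suc m) :: 'a) * fps_X ^ (m + 1)" for m
    unfolding sum_falling_neg_one_power [symmetric] by (rule act_dilation) (simp add: op_int_def)
  then show ?thesis
    by (simp add: acts_def nat_add_distrib)
qed

text \<open>By the binomial theorem for \<open>(z^i - 1) + 1\<close>, the operator
  \<open>A_i\<close> is the dilation replacing \<open>x\<close> by \<open>z^i x\<close>.\<close>

lemma acts_op_A: "acts (op_A z i) 0 (\<lambda>m. z ^ (i * m))"
proof -
  have "(\<Sum>k\<le>m. falling m k * ((z ^ i - 1) ^ k / fact k)) = z ^ (i * m)" for m
    using binomial_ring [of "z ^ i - 1" 1 m]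
    by (simp add: falling_eq_fact_binomial power_mult)
  moreover have "act (op_A z i) m =
      fps_const (\<Sum>k\<le>m. falling m k * ((z ^ i - 1) ^ k / fact k)) * fps_X ^ (m + 0)" for m
    by (rule act_dilation) (simp add: op_A_def)
  ultimately show ?thesis
    by (simp add: acts_def)
qed

text \<open>\<open>op_delta\<close> is the dilation by 0, that is, evaluation at
  \<open>x = 0\<close>; the value at \<open>m = 0\<close> comes from \<open>0^0 = 1\<close>.\<close>

lemma acts_op_delta: "acts op_delta 0 (\<lambda>m. if m = 0 then 1 else 0)"
proof -
  have "op_delta = op_A (0 :: 'a) 1"
    by (simp add: op_delta_def op_A_def fun_eq_iff)
  then show ?thesis
    using acts_op_A [of "0 :: 'a" 1] by (simp add: power_0_left)
qed

lemma acts_op_D: "acts (op_D r) r (ratio r)"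
proof (cases "r \<ge> 0")
  case True
  have "acts (op_pow op_del (nat r)) (int (nat r)) (ratio (int (nat r)))"
    by (rule acts_cong [OF acts_op_pow_del]) (simp_all only: ratio_nonneg)
  then show ?thesis
    using True by (simp add: op_D_def)
next
  case False
  have "acts (op_pow op_int s :: 'a operator) (- int s) (ratio (- int s))" for s
  proof (induction s)
    case 0
    show ?case
      unfolding op_pow.simps
      by (rule acts_cong [OF acts_op_fun]) (simp_all add: ratio_def)
  next
    case (Suc s)
    show ?case
      unfolding op_pow.simps
    proof (rule acts_cong [OF acts_op_mult [OF acts_op_int Suc]])
      fix m
      have "nat (int m + int s) = m + s" "nat (int m - (- 1 - int s)) = Suc (m + s)"
        by simp_all
      then show "1 / of_nat (Suc (nat (int m - - int s))) * ratio (- int s) m =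
          (ratio (- int (Suc s)) m :: 'a)"
        by (simp add: ratio_def)
    qed simp
  qed
  from this [of "nat (- r)"] show ?thesis
    using False by (simp add: op_D_def)
qed

lemma acts_x_A_del:
  "acts (op_pow op_x l \<star> op_A z i \<star> op_pow op_del l) 0
    (\<lambda>m. falling m l * z ^ (i * (m - l)))"
  by (rule acts_cong [OF acts_op_mult [OF acts_op_mult [OF acts_op_pow_x acts_op_A]
    acts_op_pow_del]]) (simp_all add: nat_diff_distrib' mult_ac)

text \<open>\<open>op_delta\<close> keeps only the constant term after \<open>j - 1\<close>
  derivations, and the scalar cancels \<open>(j - 1)!\<close>; so \<open>B_j\<close> is the
  projection onto \<open>x^(j-1)\<close>.\<close>

lemma acts_op_B:
  assumes "0 < j"
  shows "acts (op_B j) 0 (\<lambda>m. if Suc m = j then 1 else 0)"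
proof -
  from assms obtain i where j: "j = Suc i"
    by (cases j) auto
  show ?thesis
    unfolding op_B_def
  proof (rule acts_cong [OF acts_scale [OF acts_op_mult [OF acts_op_mult
      [OF acts_op_pow_x acts_op_delta] acts_op_pow_del]]])
    fix m
    show "1 / fact (j - 1) * (1 * (if nat (int m - int (j - 1)) = 0 then 1 else 0) * falling m (j - 1)) =
        (if Suc m = j then 1 else (0 :: 'a))"
      by (cases m i rule: linorder_cases) (auto simp: j falling_self falling_eq_0_iff [THEN iffD2])
  qed simp
qed

section \<open>Uniqueness of the canonical form\<close>

text \<open>The multiplier of the bracket in an HCP. As \<open>falling m l\<close> vanishes for
  \<open>l > m\<close>, summing to \<open>m\<close> avoids the bounds \<open>d i\<close>; the index
  \<open>Suc m\<close> reflects that \<open>B_j\<close> sees only \<open>x^(j-1)\<close>.\<close>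

definition hval :: "nat \<Rightarrow> 'a \<Rightarrow> (nat \<Rightarrow> nat \<Rightarrow> 'a) \<Rightarrow> (nat \<Rightarrow> 'a) \<Rightarrow> nat \<Rightarrow> 'a::field_char_0" where
  "hval q z f g m = (\<Sum>i<q. \<Sum>l\<le>m. f l i * (falling m l * z ^ (i * (m - l)))) + g (Suc m)"

lemma acts_hcp:
  assumes "\<forall>l i. \<not> (i < q \<and> l \<le> d i) \<longrightarrow> f l i = 0" "\<forall>j. \<not> (0 < j \<and> j \<le> N) \<longrightarrow> g j = 0"
  shows "acts (((\<Sum>i<q. \<Sum>l\<le>d i. op_scale (f l i) (op_pow op_x l \<star> op_A z i \<star> op_pow op_del l))
             + (\<Sum>j=1..N. op_scale (g j) (op_B j))) \<star> op_D r) r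
     (\<lambda>m. hval q z f g (nat (int m - r)) * ratio r m)"
proof -
  have "acts ((\<Sum>i<q. \<Sum>l\<le>d i. op_scale (f l i) (op_pow op_x l \<star> op_A z i \<star> op_pow op_del l))
             + (\<Sum>j=1..N. op_scale (g j) (op_B j))) 0
     (\<lambda>m. (\<Sum>i<q. \<Sum>l\<le>d i. f l i * (falling m l * z ^ (i * (m - l)))) +
        (\<Sum>j=1..N. g j * (if Suc m = j then 1 else 0)))"
    by (intro acts_add acts_sum acts_scale acts_x_A_del acts_op_B) simp
  then have *: "acts ((\<Sum>i<q. \<Sum>l\<le>d i. op_scale (f l i) (op_pow op_x l \<star> op_A z i \<star> op_pow op_del l))
             + (\<Sum>j=1..N. op_scale (g j) (op_B j))) 0 (hval q z f g)"
  proof (rule acts_cong)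
    fix m
    have "(\<Sum>l\<le>d i. f l i * (falling m l * z ^ (i * (m - l)))) =
        (\<Sum>l\<le>m. f l i * (falling m l * z ^ (i * (m - l))))" if "i < q" for i
    proof -
      \<comment> \<open>Beyond \<open>d i\<close> the coefficients vanish, beyond \<open>m\<close>
        the falling factorials, so both sums equal the one up to the maximum.\<close>
      have "(\<Sum>l\<le>d i. f l i * (falling m l * z ^ (i * (m - l)))) =
          (\<Sum>l\<le>max m (d i). f l i * (falling m l * z ^ (i * (m - l))))"
        using assms(1) by (intro sum.mono_neutral_left) auto
      also have "\<dots> = (\<Sum>l\<le>m. f l i * (falling m l * z ^ (i * (m - l))))"
        by (intro sum.mono_neutral_right) (auto simp: falling_eq_0_iff)
      finally show ?thesis .
    qed
    moreover have "(\<Sum>j=1..N. g j * (if Suc m = j then 1 else 0)) = g (Suc m)"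
      using assms(2) by (simp add: if_distrib cong: if_cong)
    ultimately show "(\<Sum>i<q. \<Sum>l\<le>d i. f l i * (falling m l * z ^ (i * (m - l)))) +
        (\<Sum>j=1..N. g j * (if Suc m = j then 1 else 0)) = hval q z f g m"
      by (simp add: hval_def)
  qed simp
  show ?thesis
    using acts_op_mult [OF * acts_op_D, of r] by simp
qed

text \<open>Operators are determined by their action, so the explicit expression can be traded for
  its multiplier. Later arguments about forms then concern \<open>hval\<close> alone.\<close>

lemma hcp_form_iff:
  "hcp_form F q z r f g H \<longleftrightarrow>
    (\<forall>l i. f l i \<in> F) \<and> (\<forall>j. g j \<in> F) \<and> (r < 0 \<longrightarrow> (\<forall>j. int j \<le> - r \<longrightarrow> g j = 0)) \<and>
    (\<exists>L. \<forall>l i. \<not> (i < q \<and> l \<le> L) \<longrightarrow> f l i = 0) \<and>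
    (\<exists>N. \<forall>j. \<not> (0 < j \<and> j \<le> N) \<longrightarrow> g j = 0) \<and>
    acts H r (\<lambda>m. hval q z f g (nat (int m - r)) * ratio r m)" (is "?L \<longleftrightarrow> ?R")
proof
  assume ?L
  then obtain d N where *: "\<forall>l i. f l i \<in> F" "\<forall>j. g j \<in> F"
      "r < 0 \<longrightarrow> (\<forall>j. int j \<le> - r \<longrightarrow> g j = 0)"
      "\<forall>l i. \<not> (i < q \<and> l \<le> d i) \<longrightarrow> f l i = 0" "\<forall>j. \<not> (0 < j \<and> j \<le> N) \<longrightarrow> g j = 0"
      "H = ((\<Sum>i<q. \<Sum>l\<le>d i. op_scale (f l i) (op_pow op_x l \<star> op_A z i \<star> op_pow op_del l))
             + (\<Sum>j=1..N. op_scale (g j) (op_B j))) \<star> op_D r"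
    unfolding hcp_form_def by (elim conjE exE) (rule that; assumption)
  \<comment> \<open>The sum of the \<open>d i\<close> serves as a common bound
    \<open>L\<close>.\<close>
  have "d i \<le> (\<Sum>i<q. d i)" if "i < q" for i
    using that by (intro member_le_sum) auto
  then have L: "\<forall>l i. \<not> (i < q \<and> l \<le> (\<Sum>i<q. d i)) \<longrightarrow> f l i = 0"
    using *(4) by (meson le_trans)
  have "acts H r (\<lambda>m. hval q z f g (nat (int m - r)) * ratio r m)"
    using acts_hcp [OF *(4,5), of z r] *(6) by simp
  with *(1-3,5) L show ?R
    by (intro conjI exI)
next
  assume R: ?R
  then obtain L N where L: "\<forall>l i. \<not> (i < q \<and> l \<le> L) \<longrightarrow> f l i = 0"
      and N: "\<forall>j. \<not> (0 < j \<and> j \<le> N) \<longrightarrow> g j = 0"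
    by blast
  have "H = ((\<Sum>i<q. \<Sum>l\<le>L. op_scale (f l i) (op_pow op_x l \<star> op_A z i \<star> op_pow op_del l))
             + (\<Sum>j=1..N. op_scale (g j) (op_B j))) \<star> op_D r"
    by (rule acts_inject [OF _ acts_hcp [where d = "\<lambda>_. L", OF L N, of z r]]) (use R in simp)
  with L N have "\<exists>d N. (\<forall>l i. \<not> (i < q \<and> l \<le> d i) \<longrightarrow> f l i = 0) \<and>
      (\<forall>j. \<not> (0 < j \<and> j \<le> N) \<longrightarrow> g j = 0) \<and>
      H = ((\<Sum>i<q. \<Sum>l\<le>d i. op_scale (f l i) (op_pow op_x l \<star> op_A z i \<star> op_pow op_del l))
             + (\<Sum>j=1..N. op_scale (g j) (op_B j))) \<star> op_D r"
    by (intro exI conjI)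
  with R show ?L
    unfolding hcp_form_def by (elim conjE) (intro conjI; assumption)
qed

lemma hcp_formD:
  assumes "hcp_form F q z r f g H"
  shows hcp_form_f_mem: "f l i \<in> F"
    and hcp_form_g_mem: "g j \<in> F"
    and hcp_form_g_low: "r < 0 \<Longrightarrow> int j \<le> - r \<Longrightarrow> g j = 0"
    and hcp_form_f_bounded: "\<exists>L. \<forall>l i. \<not> (i < q \<and> l \<le> L) \<longrightarrow> f l i = 0"
    and hcp_form_g_bounded: "\<exists>N. \<forall>j. \<not> (0 < j \<and> j \<le> N) \<longrightarrow> g j = 0"
    and hcp_form_acts: "acts H r (\<lambda>m. hval q z f g (nat (int m - r)) * ratio r m)"
proof -
  note iff = assms [unfolded hcp_form_iff]
  show "f l i \<in> F"
    using iff [THEN conjunct1] by simp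
  show "g j \<in> F"
    using iff [THEN conjunct2, THEN conjunct1] by simp
  show "r < 0 \<Longrightarrow> int j \<le> - r \<Longrightarrow> g j = 0"
    using iff [THEN conjunct2, THEN conjunct2, THEN conjunct1] by simp
  show "\<exists>L. \<forall>l i. \<not> (i < q \<and> l \<le> L) \<longrightarrow> f l i = 0"
    by (rule iff [THEN conjunct2, THEN conjunct2, THEN conjunct2, THEN conjunct1])
  show "\<exists>N. \<forall>j. \<not> (0 < j \<and> j \<le> N) \<longrightarrow> g j = 0"
    by (rule iff [THEN conjunct2, THEN conjunct2, THEN conjunct2, THEN conjunct2, THEN conjunct1])
  show "acts H r (\<lambda>m. hval q z f g (nat (int m - r)) * ratio r m)"
    by (rule iff [THEN conjunct2, THEN conjunct2, THEN conjunct2, THEN conjunct2, THEN conjunct2])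
qed

section \<open>Linear independence of falling factorials and of powers of a root of unity\<close>

lemma falling_sum_triangular:
  fixes a :: "nat \<Rightarrow> 'a::field_char_0"
  assumes "\<And>m. m < N \<Longrightarrow> (\<Sum>l\<le>m. a l * falling m l) = 0" "l < N"
  shows "a l = 0"
  using assms(2)
proof (induction l rule: less_induct)
  case (less l)
  have "(\<Sum>l'\<le>l. a l' * falling l l') = a l * falling l l"
    using less by (simp add: lessThan_Suc_atMost [symmetric])
  then show ?case
    using assms(1) [of l] less.prems by (simp add: falling_self)
qed

text \<open>The sum is a polynomial in \<open>m\<close>, written in the Newton basis, with
  infinitely many zeros. It is therefore zero at every \<open>m\<close>, where the triangular
  argument applies.\<close>

lemma falling_sum_eq_0_imp:
  fixes a :: "nat \<Rightarrow> 'a::field_char_0"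
  assumes "infinite M" "\<And>m. m \<in> M \<Longrightarrow> (\<Sum>l\<le>m. a l * falling m l) = 0" "\<And>l. l > L \<Longrightarrow> a l = 0"
  shows "a l = 0"
proof -
  define p where "p = (\<Sum>l\<le>L. smult (a l) (\<Prod>i<l. [:- of_nat i, 1:]))"
  have p: "poly p (of_nat m) = (\<Sum>l\<le>m. a l * falling m l)" for m
  proof -
    have "poly p (of_nat m) = (\<Sum>l\<le>L. a l * falling m l)"
      by (simp add: p_def poly_sum poly_prod falling_def)
    also have "\<dots> = (\<Sum>l\<le>max L m. a l * falling m l)"
      using assms(3) by (intro sum.mono_neutral_left) auto
    also have "\<dots> = (\<Sum>l\<le>m. a l * falling m l)"
      by (intro sum.mono_neutral_right) (auto simp: falling_eq_0_iff)
    finally show ?thesis .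
  qed
  have "p = 0"
  proof (rule ccontr)
    assume "p \<noteq> 0"
    then have "finite {x. poly p x = 0}"
      by (rule poly_roots_finite)
    moreover have "of_nat ` M \<subseteq> {x. poly p x = 0}"
      using assms(2) p by auto
    ultimately have "finite (of_nat ` M :: 'a set)"
      by (rule rev_finite_subset)
    then have "finite M"
      by (rule finite_imageD) (simp add: inj_on_def)
    with assms(1) show False
      by contradiction
  qed
  then have "(\<Sum>l\<le>m. a l * falling m l) = 0" for m
    using p [of m] by simp
  then show ?thesis
    by (rule falling_sum_triangular) (rule lessI)
qed

lemma primitive_root_powers_inj:
  assumes "primitive_root q z"
  shows "inj_on (\<lambda>c. z ^ (d + c)) {..<q}"
proof -
  have *: False if "a < b" "b < q" "z ^ (d + a) = z ^ (d + b)" for a b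
  proof -
    have "z \<noteq> 0"
      using assms by (auto simp: primitive_root_def power_0_left)
    moreover have "z ^ (d + b) = z ^ (d + a) * z ^ (b - a)"
      using that(1) by (simp flip: power_add)
    ultimately have "z ^ (b - a) = 1"
      using that(3) by simp
    then show False
      using assms that(1,2) by (auto simp: primitive_root_def)
  qed
  show ?thesis
    by (rule inj_onI) (metis * lessThan_iff linorder_neqE_nat)
qed

text \<open>A Vandermonde argument: the polynomial with coefficients \<open>b i\<close> has degree
  below \<open>q\<close> and vanishes at \<open>q\<close> distinct powers of
  \<open>z\<close>.\<close>

lemma primitive_root_sum_eq_0_imp:
  assumes "primitive_root q z" "\<And>c. c < q \<Longrightarrow> (\<Sum>i<q. b i * z ^ (i * (d + c))) = 0" "i < q"
  shows "b i = 0"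
proof -
  define p where "p = (\<Sum>i<q. monom (b i) i)"
  have "p = 0"
  proof (rule poly_eqI_degree)
    show "poly p x = poly 0 x" if "x \<in> (\<lambda>c. z ^ (d + c)) ` {..<q}" for x
    proof -
      from that obtain c where "c < q" "x = z ^ (d + c)"
        by auto
      then show ?thesis
        using assms(2) [of c] by (simp add: p_def poly_sum poly_monom mult.commute flip: power_mult)
    qed
    have "degree p \<le> q - 1"
      unfolding p_def by (intro degree_sum_le) (auto intro: order.trans [OF degree_monom_le])
    then show "degree p < card ((\<lambda>c. z ^ (d + c)) ` {..<q})"
      "degree 0 < card ((\<lambda>c. z ^ (d + c)) ` {..<q})"
      using assms(3) by (simp_all add: card_image primitive_root_powers_inj [OF assms(1)])
  qed
  moreover have "coeff p i = b i"
    using assms(3) by (simp add: p_def coeff_sum)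
  ultimately show ?thesis
    by simp
qed

text \<open>On each residue class modulo \<open>q\<close> the quasi-polynomial is a polynomial,
  hence zero; comparing \<open>q\<close> consecutive classes then separates the indices
  \<open>i\<close>.\<close>

lemma hval_eq_0_imp:
  assumes "primitive_root q z"
    and L: "\<And>l i. \<not> (i < q \<and> l \<le> L) \<Longrightarrow> f l i = 0"
    and 0: "\<And>m. m \<ge> M \<Longrightarrow> hval q z f (\<lambda>_. 0) m = 0"
  shows "f l i = 0"
proof (cases "i < q \<and> l \<le> L")
  case True
  \<comment> \<open>\<open>a c\<close> holds the Newton coefficients on the class
    \<open>m = c + q t\<close>, where \<open>z^(i(m - l))\<close> does not depend on
    \<open>t\<close>.\<close>
  define a where "a = (\<lambda>c l. if l \<le> L then \<Sum>i<q. f l i * z ^ (i * (c - l)) else 0)"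
  have "q > 0" and z: "z ^ q = 1"
    using assms(1) by (auto simp: primitive_root_def)
  \<comment> \<open>\<open>L \<le> c\<close> keeps the natural subtraction \<open>c - l\<close>
    exact for every \<open>l \<le> L\<close>.\<close>
  have a: "a c l = 0" if "L \<le> c" for c l
  proof (rule falling_sum_eq_0_imp)
    show "infinite ((\<lambda>t. c + q * t) ` {M..})"
      using \<open>q > 0\<close> by (auto simp: inj_on_def infinite_Ici dest!: finite_imageD)
    show "(\<Sum>l\<le>m. a c l * falling m l) = 0" if m: "m \<in> (\<lambda>t. c + q * t) ` {M..}" for m
    proof -
      from m obtain t where t: "t \<ge> M" "m = c + q * t"
        by auto
      have "t \<le> q * t"
        using \<open>q > 0\<close> by simp
      have eq: "a c l * falling m l = (\<Sum>i<q. f l i * (falling m l * z ^ (i * (m - l))))" for l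
      proof (cases "l \<le> L")
        case True
        have "z ^ (i * (m - l)) = z ^ (i * (c - l))" for i
        proof -
          have "i * (m - l) = i * (c - l) + q * (i * t)"
            using True \<open>L \<le> c\<close> t(2) by (simp add: algebra_simps flip: add_mult_distrib2)
          then show ?thesis
            by (simp add: power_add power_mult z)
        qed
        with True show ?thesis
          by (simp add: a_def sum_distrib_left mult_ac)
      qed (simp add: a_def L)
      show ?thesis
        unfolding eq using 0 [of m] t \<open>t \<le> q * t\<close>
        by (subst sum.swap) (simp add: hval_def)
    qed
    show "a c l = 0" if "L < l" for l
      using that by (simp add: a_def)
  qed
  show ?thesis
  proof (rule primitive_root_sum_eq_0_imp [OF assms(1)])
    show "(\<Sum>i<q. f l i * z ^ (i * (L - l + c))) = 0" if "c < q" for c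
    proof -
      have "L + c - l = L - l + c"
        using True by simp
      then show ?thesis
        using a [of "L + c" l] True by (simp add: a_def)
    qed
  qed (use True in simp)
qed (use L in auto)

lemma hval_diff:
  "hval q z (\<lambda>l i. f l i - f' l i) (\<lambda>j. g j - g' j) m = hval q z f g m - hval q z f' g' m"
  by (simp add: hval_def algebra_simps sum_subtractf)

lemma ratio_eq_0_iff: "ratio r m = 0 \<longleftrightarrow> int m < r"
  by (simp add: ratio_def)

text \<open>For large \<open>m\<close> the \<open>B_j\<close> are invisible, so the quasi-polynomial
  parts agree; the remaining values give \<open>g\<close>. Values at \<open>m < -r\<close> are not
  observed, but there the form itself demands \<open>g = 0\<close>.\<close>

lemma hcp_form_unique_same_degree:
  assumes "primitive_root q z" "hcp_form F q z r f g H" "hcp_form F q z r f' g' H"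
  shows "f = f' \<and> g = g'"
proof -
  define F' G' where "F' = (\<lambda>l i. f l i - f' l i)" and "G' = (\<lambda>j. g j - g' j)"
  obtain L where L: "\<And>l i. \<not> (i < q \<and> l \<le> L) \<Longrightarrow> f l i = 0"
    using hcp_form_f_bounded [OF assms(2)] by blast
  obtain L' where L': "\<And>l i. \<not> (i < q \<and> l \<le> L') \<Longrightarrow> f' l i = 0"
    using hcp_form_f_bounded [OF assms(3)] by blast
  obtain N where N: "\<And>j. \<not> (0 < j \<and> j \<le> N) \<Longrightarrow> g j = 0"
    using hcp_form_g_bounded [OF assms(2)] by blast
  obtain N' where N': "\<And>j. \<not> (0 < j \<and> j \<le> N') \<Longrightarrow> g' j = 0"
    using hcp_form_g_bounded [OF assms(3)] by blast
  have 0: "hval q z F' G' m = 0" if "- r \<le> int m" for m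
  proof -
    \<comment> \<open>\<open>D^r\<close> sends \<open>x^n\<close> to a nonzero multiple of
      \<open>x^m\<close>, so the factor \<open>ratio r n\<close> can be cancelled.\<close>
    define n where "n = nat (int m + r)"
    have n: "nat (int n - r) = m" "r \<le> int n"
      using that by (simp_all add: n_def)
    have "hval q z f g (nat (int n - r)) * ratio r n = hval q z f' g' (nat (int n - r)) * ratio r n"
      using acts_unique [OF assms(2,3) [THEN hcp_form_acts]] by (rule fun_cong)
    then show ?thesis
      using n by (simp add: F'_def G'_def hval_diff ratio_eq_0_iff [of r n])
  qed
  have F': "F' = (\<lambda>_ _. 0)"
  proof (intro ext)
    fix l i
    show "F' l i = 0"
    proof (rule hval_eq_0_imp [OF assms(1), where L = "max L L'"])
      show "hval q z F' (\<lambda>_. 0) m = 0" if "m \<ge> nat (- r) + N + N'" for m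
      proof -
        have "G' (Suc m) = 0"
          using N [of "Suc m"] N' [of "Suc m"] that by (simp add: G'_def)
        then show ?thesis
          using 0 [of m] that by (simp add: hval_def)
      qed
      show "F' l i = 0" if "\<not> (i < q \<and> l \<le> max L L')" for l i
        using that L [of i l] L' [of i l] by (auto simp: F'_def le_max_iff_disj)
    qed
  qed
  have "G' j = 0" for j
  proof (cases "j = 0 \<or> r < 0 \<and> int j \<le> - r")
    case True
    then show ?thesis
      using N [of 0] N' [of 0] assms(2,3) [THEN hcp_form_g_low] by (auto simp: G'_def)
  next
    case False
    then obtain m where "j = Suc m" "- r \<le> int m"
      by (cases j) auto
    then show ?thesis
      using 0 [of m] by (simp add: F' hval_def)
  qed
  with F' show ?thesis
    by (simp add: F'_def G'_def fun_eq_iff)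
qed

lemma hcp_form_zero: "0 \<in> F \<Longrightarrow> hcp_form F q z r (\<lambda>_ _. 0) (\<lambda>_. 0) 0"
  by (simp add: hcp_form_iff hval_def acts_zero)

lemma hcp_form_imp_zero_mem:
  assumes "hcp_form F q z r f g H"
  shows "0 \<in> F"
proof -
  obtain N where "\<And>j. \<not> (0 < j \<and> j \<le> N) \<Longrightarrow> g j = 0"
    using hcp_form_g_bounded [OF assms] by blast
  from this [of 0] hcp_form_g_mem [OF assms, of 0] show ?thesis
    by simp
qed

text \<open>The exponents are not compared: 0 has a form with every exponent, always with zero
  coefficients.\<close>

lemma hcp_form_unique:
  assumes "primitive_root q z" "hcp_form F q z r f g H" "hcp_form F q z r' f' g' H"
  shows "f = f' \<and> g = g'"
proof (cases "H = 0")
  case True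
  have "f = (\<lambda>_ _. 0) \<and> g = (\<lambda>_. 0)" if "hcp_form F q z r f g H" for r f g
    by (rule hcp_form_unique_same_degree [OF assms(1) that])
      (simp add: True hcp_form_zero hcp_form_imp_zero_mem [OF that])
  from this [OF assms(2)] this [OF assms(3)] show ?thesis
    by simp
next
  case False
  then have "r = r'"
    using assms(2,3) [THEN hcp_form_acts] acts_degree_unique by blast
  with assms show ?thesis
    using hcp_form_unique_same_degree by simp
qed

text \<open>Uniqueness lets the existential over all forms be evaluated on any one form at hand;
  likewise for \<open>Sdeg_B\<close> and \<open>contains_A\<close>.\<close>

lemma Sdeg_A_eq:
  assumes "primitive_root q z" "hcp_form F q z r f g H"
  shows "Sdeg_A F q z H = Sup {ereal (real l) | l. \<exists>i. f l i \<noteq> 0}"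
  unfolding Sdeg_A_def using hcp_form_unique [OF assms] assms(2)
  by (intro arg_cong [where f = Sup] Collect_cong) blast

lemma Sdeg_B_eq:
  assumes "primitive_root q z" "hcp_form F q z r f g H"
  shows "Sdeg_B F q z H = Sup {ereal (real j) | j. g j \<noteq> 0}"
  unfolding Sdeg_B_def using hcp_form_unique [OF assms] assms(2)
  by (intro arg_cong [where f = Sup] Collect_cong) blast

lemma Sdeg_B_eq_MInfty_iff:
  assumes "primitive_root q z" "hcp_form F q z r f g H"
  shows "Sdeg_B F q z H = -\<infinity> \<longleftrightarrow> (\<forall>j. g j = 0)"
  by (auto simp: Sdeg_B_eq [OF assms] Sup_eq_MInfty bot_ereal_def)

lemma contains_A_iff:
  assumes "primitive_root q z" "hcp_form F q z r f g H"
  shows "contains_A F q z H \<longleftrightarrow> (\<exists>i l. i > 0 \<and> f l i \<noteq> 0)"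
  unfolding contains_A_def using hcp_form_unique [OF assms] assms(2) by blast

section \<open>Forms containing only \<open>A\<^sub>0\<close>\<close>

definition pure :: "(nat \<Rightarrow> 'a) \<Rightarrow> nat \<Rightarrow> nat \<Rightarrow> 'a::zero" where
  "pure a = (\<lambda>l i. if i = 0 then a l else 0)"

lemma pure_eq_0_iff [simp]: "pure a l i = 0 \<longleftrightarrow> i > 0 \<or> a l = 0"
  by (simp add: pure_def)

lemma hval_pure:
  assumes "q > 0"
  shows "hval q z (pure a) g m = (\<Sum>l\<le>m. a l * falling m l) + g (Suc m)"
proof -
  have "hval q z (pure a) g m =
      (\<Sum>i<q. if i = 0 then \<Sum>l\<le>m. a l * falling m l else 0) + g (Suc m)"
    unfolding hval_def by (intro arg_cong2 [where f = "(+)"] sum.cong refl) (simp add: pure_def)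
  then show ?thesis
    using assms by simp
qed

text \<open>The operator \<open>\<Sum>l. a l x^l \<partial>^(l + t)\<close>, with coefficients
  indexed by the power of \<open>x\<close>; terms with \<open>l + t < 0\<close> are dropped.\<close>

definition homogeneous_operator :: "int \<Rightarrow> (nat \<Rightarrow> 'a) \<Rightarrow> 'a::field_char_0 operator" where
  "homogeneous_operator t a = (\<lambda>k. if t \<le> int k
     then fps_const (a (nat (int k - t))) * fps_X ^ nat (int k - t) else 0)"

text \<open>Cancelling \<open>(m - t)!\<close> shows that \<open>x^l \<partial>^l D^t\<close> acts
  as \<open>x^l \<partial>^(l + t)\<close> when \<open>l + t \<ge> 0\<close>.\<close>

lemma falling_mult_ratio:
  assumes "int k - int l = t" "k \<le> m"
  shows "falling (nat (int m - t)) l * ratio t m = falling m k"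
proof -
  have "l \<le> nat (int m - t)" "nat (int m - t) - l = m - k" "t \<le> int m"
    using assms by simp_all
  then show ?thesis
    using assms by (simp add: falling_eq_fact_div ratio_def)
qed

lemma acts_homogeneous_operator:
  assumes "q > 0" "\<And>l. int l < - t \<Longrightarrow> a l = 0"
  shows "acts (homogeneous_operator t a) t
    (\<lambda>m. hval q z (pure a) (\<lambda>_. 0) (nat (int m - t)) * ratio t m)"
proof -
  have "(\<Sum>k\<le>m. if t \<le> int k then falling m k * a (nat (int k - t)) else 0) =
      hval q z (pure a) (\<lambda>_. 0) (nat (int m - t)) * ratio t m" for m
  proof (cases "t \<le> int m")
    case True
    have "(\<Sum>k\<le>m. if t \<le> int k then falling m k * a (nat (int k - t)) else 0) =
        (\<Sum>k | k \<le> m \<and> t \<le> int k. falling m k * a (nat (int k - t)))"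
      by (intro sum.mono_neutral_cong_right) auto
    also have "\<dots> = (\<Sum>l | l \<le> nat (int m - t) \<and> - t \<le> int l.
        a l * falling (nat (int m - t)) l * ratio t m)"
    proof (rule sum.reindex_bij_witness [where i = "\<lambda>l. nat (int l + t)" and j = "\<lambda>k. nat (int k - t)"])
      fix k
      assume "k \<in> {k. k \<le> m \<and> t \<le> int k}"
      then show "a (nat (int k - t)) * falling (nat (int m - t)) (nat (int k - t)) * ratio t m =
          falling m k * a (nat (int k - t))"
        using falling_mult_ratio [of k "nat (int k - t)" t m, where 'a = 'a] by simp
    qed (use True in auto)
    \<comment> \<open>The indices \<open>l < -t\<close>, absent from the differential operator,
      enter here with coefficient 0.\<close>
    also have "\<dots> = (\<Sum>l\<le>nat (int m - t). a l * falling (nat (int m - t)) l * ratio t m)"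
      by (intro sum.mono_neutral_left) (auto, meson assms(2) not_le)
    finally show ?thesis
      by (simp add: hval_pure [OF assms(1)] sum_distrib_right)
  next
    case False
    then show ?thesis
      by (simp add: ratio_def)
  qed
  moreover have "act (homogeneous_operator t a) m =
      fps_const (\<Sum>k\<le>m. if t \<le> int k then falling m k * a (nat (int k - t)) else 0) *
      fps_X ^ nat (int m - t)" for m
    unfolding act_eq by (rule sum_homogeneous) (auto simp: homogeneous_operator_def)
  ultimately show ?thesis
    by (simp add: acts_def ratio_eq_0_iff)
qed

lemma hcp_form_pureI:
  assumes "q > 0" "0 \<in> F" "\<And>l. a l \<in> F" "\<And>l. l > L \<Longrightarrow> a l = 0"
    and "acts H r (\<lambda>m. hval q z (pure a) (\<lambda>_. 0) (nat (int m - r)) * ratio r m)"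
  shows "hcp_form F q z r (pure a) (\<lambda>_. 0) H"
  unfolding hcp_form_iff
proof (intro conjI)
  show "\<exists>L. \<forall>l i. \<not> (i < q \<and> l \<le> L) \<longrightarrow> pure a l i = 0"
    using assms(1,4) by (intro exI [of _ L]) auto
qed (use assms in \<open>auto simp: pure_def\<close>)

text \<open>On \<open>x^m\<close> the rule \<open>D^t D^s = D^(t+s)\<close> needs
  \<open>m \<ge> s\<close>: for smaller \<open>m\<close>, \<open>D^s\<close> kills
  \<open>x^m\<close> while \<open>D^(t+s)\<close> need not.\<close>

lemma ratio_mult:
  assumes "s \<le> int m"
  shows "ratio t (nat (int m - s)) * ratio s m = ratio (t + s) m"
  using assms by (auto simp: ratio_def diff_diff_eq add.commute)

text \<open>Vanishing of \<open>a\<close> below \<open>-t\<close> makes the bracket kill exactly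
  those monomials where \<open>D^t D^s\<close> and \<open>D^(t+s)\<close> could differ, so no
  \<open>B_j\<close> arises.\<close>

lemma hcp_form_pure_mult_D:
  assumes "q > 0" "hcp_form F q z t (pure a) (\<lambda>_. 0) H" "\<And>l. int l < - t \<Longrightarrow> a l = 0"
  shows "hcp_form F q z (t + s) (pure a) (\<lambda>_. 0) (H \<star> op_D s)"
proof -
  note H = hcp_form_acts [OF assms(2)]
  note F = hcp_form_f_mem [OF assms(2)]
  obtain L where L: "\<And>l i. \<not> (i < q \<and> l \<le> L) \<Longrightarrow> pure a l i = 0"
    using hcp_form_f_bounded [OF assms(2)] by blast
  show ?thesis
  proof (rule hcp_form_pureI)
    show "a l \<in> F" for l
      using F [of l 0] by (simp add: pure_def)
    show "a l = 0" if "l > L" for l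
      using L [of 0 l] that by simp
    show "acts (H \<star> op_D s) (t + s)
        (\<lambda>m. hval q z (pure a) (\<lambda>_. 0) (nat (int m - (t + s))) * ratio (t + s) m)"
    proof (rule acts_cong [OF acts_op_mult [OF H acts_op_D]])
      fix m
      show "hval q z (pure a) (\<lambda>_. 0) (nat (int (nat (int m - s)) - t)) *
          ratio t (nat (int m - s)) * ratio s m =
        hval q z (pure a) (\<lambda>_. 0) (nat (int m - (t + s))) * ratio (t + s) m"
      proof (cases "s \<le> int m")
        case True
        then have "nat (int (nat (int m - s)) - t) = nat (int m - (t + s))"
          by simp
        then show ?thesis
          by (simp add: mult.assoc ratio_mult [OF True])
      next
        case False
        \<comment> \<open>From \<open>m < s\<close> follows \<open>m - (t + s) < -t\<close>, so only
          coefficients known to be 0 occur in the sum.\<close>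
        have "hval q z (pure a) (\<lambda>_. 0) (nat (int m - (t + s))) = 0" if "t + s \<le> int m"
          unfolding hval_pure [OF assms(1)] using False that assms(3)
          by (auto intro!: sum.neutral)
        then show ?thesis
          using False by (auto simp: ratio_def)
      qed
    qed simp
  qed (use assms hcp_form_imp_zero_mem in auto)
qed

section \<open>Subfields of scalars and consequences of total freedom of \<open>B_j\<close>\<close>

lemma subfield_sum:
  assumes "is_subfield F" "\<And>i. i \<in> A \<Longrightarrow> f i \<in> F"
  shows "(\<Sum>i\<in>A. f i) \<in> F"
  using assms(2)
  by (induction A rule: infinite_finite_induct) (use assms(1) in \<open>auto simp: is_subfield_def\<close>)

lemma subfield_of_nat: "is_subfield F \<Longrightarrow> of_nat n \<in> F"
  by (induction n) (auto simp: is_subfield_def)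

lemma subfield_falling:
  assumes "is_subfield F"
  shows "falling m l \<in> F"
proof -
  have "falling m l = of_nat (fact l * (m choose l))"
    by (simp add: falling_eq_fact_binomial)
  then show ?thesis
    using subfield_of_nat [OF assms] by metis
qed

lemma is_subfield_adjoin: "is_subfield (adjoin F z)"
  unfolding is_subfield_def adjoin_def by blast

lemma subset_adjoin: "F \<subseteq> adjoin F z"
  unfolding adjoin_def by blast

lemma op_mult_D_0:
  assumes "acts H r e"
  shows "H \<star> op_D 0 = H"
proof (rule acts_inject)
  show "acts (H \<star> op_D 0) r e"
    by (rule acts_cong [OF acts_op_mult [OF assms acts_op_D]]) (simp_all add: ratio_def)
qed fact

text \<open>
  For \<open>t < 0\<close> and \<open>n = -t\<close>, right multiplication by \<open>\<partial>\<^sup>n\<close> turns the factor \<open>D\<^sup>t\<close> into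
  \<open>1 - B\<^sub>1 - \<dots> - B\<^sub>n\<close>, and the \<open>B\<^sub>j\<close> drop out only if the remaining factor kills
  all \<open>x\<^sup>m\<close> with \<open>m < n\<close>.
\<close>

lemma coeff_eq_0_if_Sdeg_B_mult_D:
  assumes "primitive_root q z" "is_subfield F" "hcp_form F q z t (pure a) (\<lambda>_. 0) H"
    and "Sdeg_B F q z (H \<star> op_D (- t)) = -\<infinity>" "int l < - t"
  shows "a l = 0"
proof -
  have "q > 0"
    using assms(1) by (simp add: primitive_root_def)
  note H = hcp_form_acts [OF assms(3)]
  note F = hcp_form_f_mem [OF assms(3)]
  obtain L where L: "\<And>l i. \<not> (i < q \<and> l \<le> L) \<Longrightarrow> pure a l i = 0"
    using hcp_form_f_bounded [OF assms(3)] by blast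
  define h where "h = (\<lambda>m. \<Sum>l\<le>m. a l * falling m l)"
  \<comment> \<open>For \<open>m < -t\<close> the product kills \<open>x^m\<close> although the
    bracket alone gives \<open>h m\<close>; as \<open>B_(m+1)\<close> projects onto
    \<open>x^m\<close>, its coefficient must be \<open>- h m\<close>.\<close>
  define g where "g = (\<lambda>j. if 0 < j \<and> int j \<le> - t then - h (j - 1) else 0)"
  have a: "a l \<in> F" for l
    using F [of l 0] by (simp add: pure_def)
  have "h m \<in> F" for m
    unfolding h_def
    by (intro subfield_sum assms(2))
      (use assms(2) a subfield_falling [OF assms(2)] in \<open>auto simp: is_subfield_def\<close>)
  then have gF: "g j \<in> F" for j
    using assms(2) by (auto simp: g_def is_subfield_def)
  have "acts (H \<star> op_D (- t)) 0 (\<lambda>m. hval q z (pure a) g (nat (int m - 0)) * ratio 0 m)"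
  proof (rule acts_cong [OF acts_op_mult [OF H acts_op_D]])
    fix m
    show "hval q z (pure a) (\<lambda>_. 0) (nat (int (nat (int m - - t)) - t)) *
        ratio t (nat (int m - - t)) * ratio (- t) m =
        hval q z (pure a) g (nat (int m - 0)) * ratio 0 m"
    proof (cases "- t \<le> int m")
      case True
      then show ?thesis
        using ratio_mult [OF True, of t, where 'a = 'a]
        by (simp add: mult.assoc hval_pure [OF \<open>q > 0\<close>] g_def)
    next
      case False
      then show ?thesis
        by (simp add: hval_pure [OF \<open>q > 0\<close>] g_def h_def ratio_def)
    qed
  qed simp
  then have "hcp_form F q z 0 (pure a) g (H \<star> op_D (- t))"
    unfolding hcp_form_iff
  proof (intro conjI exI)
    show "\<forall>l i. \<not> (i < q \<and> l \<le> L) \<longrightarrow> pure a l i = 0"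
      using L by blast
    show "\<forall>j. \<not> (0 < j \<and> j \<le> nat (- t)) \<longrightarrow> g j = 0"
      by (auto simp: g_def)
  qed (use F gF in auto)
  then have g_0: "g (Suc m) = 0" for m
    using Sdeg_B_eq_MInfty_iff assms(1,4) by blast
  have "h m = 0" if "int m < - t" for m
    using g_0 [of m] that by (simp add: g_def)
  then show ?thesis
    using assms(5) by (intro falling_sum_triangular [of "nat (- t)" a]) (auto simp: h_def)
qed

section \<open>Homogeneous components and the order\<close>

lemma hcomp_nth: "fps_nth (hcomp P (int k - int j) k) j = fps_nth (P k) j"
  by (simp add: hcomp_def)

text \<open>The guard sets the coefficients with \<open>l < -t\<close> to 0, as
  \<open>acts_homogeneous_operator\<close> requires.\<close>

lemma hcomp_eq:
  "hcomp P t =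
    homogeneous_operator t (\<lambda>l. if 0 \<le> int l + t then fps_nth (P (nat (int l + t))) l else 0)"
  by (auto simp: hcomp_def homogeneous_operator_def fun_eq_iff)

text \<open>Membership in \<open>Hcpc\<close> leaves the exponent open. A nonzero component acts
  with degree \<open>t\<close>, which fixes it; the form of 0 is valid with any exponent.\<close>

lemma hcp_form_hcomp_degree:
  assumes "primitive_root q z" "hcp_form F q z r f g (hcomp P t)"
  shows "hcp_form F q z t f g (hcomp P t)"
proof (cases "hcomp P t = 0")
  case True
  have 0: "hcp_form F q z t (\<lambda>_ _. 0) (\<lambda>_. 0) (hcomp P t)"
    unfolding True using hcp_form_imp_zero_mem [OF assms(2)] by (rule hcp_form_zero)
  then show ?thesis
    using hcp_form_unique [OF assms 0] by simp
next
  case False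
  have "\<exists>e. acts (hcomp P t) t e"
    unfolding hcomp_eq by (rule exI, rule acts_homogeneous_operator [of 1]) simp_all
  then have "r = t"
    using False acts_degree_unique hcp_form_acts [OF assms(2)] by blast
  with assms(2) show ?thesis
    by simp
qed

text \<open>The monomial \<open>x^j \<partial>^k\<close> bounds the order from below; with the upper
  bound \<open>op_ord P\<close> is real, so \<open>real_of_ereal\<close> does not fall back to its
  default value.\<close>

lemma int_ord_ge:
  assumes "op_ord P < \<infinity>" "fps_nth (P k) j \<noteq> 0"
  shows "int k - int j \<le> int_ord P"
proof -
  have "P k \<noteq> 0" "subdegree (P k) \<le> j"
    using assms(2) by (auto intro: subdegree_leI)
  then have "ereal (real k - real j) \<le> ereal (real k) - xval (P k)"
    by (simp add: xval_def)
  also have "\<dots> \<le> op_ord P"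
    unfolding op_ord_def by (rule SUP_upper) simp
  finally have "real k - real j \<le> real_of_ereal (op_ord P)"
    using assms(1) by (cases "op_ord P") auto
  then show ?thesis
    unfolding int_ord_def by (simp add: le_floor_iff)
qed

lemma int_ord_const_top:
  assumes "P n = fps_const c" "c \<noteq> 0" "\<And>k. k > n \<Longrightarrow> P k = 0"
  shows "int_ord P = int n"
proof -
  have "op_ord P = ereal (real n)"
    unfolding op_ord_def
  proof (rule antisym)
    show "(SUP k. ereal (real k) - xval (P k)) \<le> ereal (real n)"
    proof (rule SUP_least)
      fix k
      show "ereal (real k) - xval (P k) \<le> ereal (real n)"
        using assms(3) [of k] by (cases "k > n") (auto simp: xval_def)
    qed
    have "ereal (real n) = ereal (real n) - xval (P n)"
      using assms(1,2) by (simp add: xval_def)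
    also have "\<dots> \<le> (SUP k. ereal (real k) - xval (P k))"
      by (rule SUP_upper) simp
    finally show "ereal (real n) \<le> (SUP k. ereal (real k) - xval (P k))" .
  qed
  then show ?thesis
    by (simp add: int_ord_def)
qed

section \<open>Constant highest symbol and the condition \<open>A_p(0)\<close>\<close>

lemma differential_operator_imp_condition:
  assumes "primitive_root p (z p)" "is_subfield F" "P \<in> op_over F" "has_constant_highest_symbol F P"
  shows "condition_A0_without_A F z p P"
proof -
  define E where "E = adjoin F (z p)"
  have "p > 0"
    using assms(1) by (simp add: primitive_root_def)
  from assms(4) obtain n c where n: "P n = fps_const c" "c \<noteq> 0" "\<And>k. k > n \<Longrightarrow> P k = 0"
    unfolding has_constant_highest_symbol_def by blast
  have E: "is_subfield E" "F \<subseteq> E"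
    by (simp_all add: E_def is_subfield_adjoin subset_adjoin)
  have ord: "int_ord P = int n"
    by (rule int_ord_const_top) (use n in auto)
  define a where "a = (\<lambda>t l. if 0 \<le> int l + t then fps_nth (P (nat (int l + t))) l else 0)"
  have top: "a t l = 0" if "int l + t > int n" for t l
    using that n(3) by (simp add: a_def)
  have form: "hcp_form E p (z p) t (pure (a t)) (\<lambda>_. 0) (hcomp P t)" for t
  proof (rule hcp_form_pureI)
    show "a t l \<in> E" for l
      using assms(3) E by (auto simp: a_def op_over_def is_subfield_def)
    \<comment> \<open>The order \<open>n\<close> in \<open>\<partial>\<close> forces
      \<open>l + t \<le> n\<close>, which makes the form finite.\<close>
    show "a t l = 0" if "l > nat (int n - t)" for l
      using that by (intro top) simp
    show "acts (hcomp P t) t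
        (\<lambda>m. hval p (z p) (pure (a t)) (\<lambda>_. 0) (nat (int m - t)) * ratio t m)"
      unfolding hcomp_eq a_def using \<open>p > 0\<close> by (rule acts_homogeneous_operator) simp
  qed (use E \<open>p > 0\<close> in \<open>auto simp: is_subfield_def\<close>)
  note A = Sdeg_A_eq [OF assms(1) form]
  have free: "totally_free_of_B E p (z p) (hcomp P t)" for t
    unfolding totally_free_of_B_def
  proof
    fix s
    have "hcp_form E p (z p) (t + s) (pure (a t)) (\<lambda>_. 0) (hcomp P t \<star> op_D s)"
      using \<open>p > 0\<close> form by (rule hcp_form_pure_mult_D) (simp add: a_def)
    then show "Sdeg_B E p (z p) (hcomp P t \<star> op_D s) = - \<infinity>"
      by (simp add: Sdeg_B_eq_MInfty_iff [OF assms(1)])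
  qed
  have less: "Sdeg_A E p (z p) (hcomp P (int_ord P - int i)) < ereal (real (i + 0))" if "i > 0" for i
  proof -
    \<comment> \<open>The term is \<open>x^l \<partial>^(n - i + l)\<close>: for
      \<open>l > i\<close> it exceeds the order, and \<open>l = i > 0\<close> would make the leading
      coefficient nonconstant.\<close>
    have "l \<le> i - 1" if "a (int n - int i) l \<noteq> 0" for l
    proof (rule ccontr)
      assume "\<not> l \<le> i - 1"
      moreover have "\<not> int l + (int n - int i) > int n"
        using top that by blast
      ultimately have "l = i"
        by simp
      with that \<open>i > 0\<close> show False
        by (simp add: a_def n(1))
    qed
    then have "Sdeg_A E p (z p) (hcomp P (int_ord P - int i)) \<le> ereal (real (i - 1))"
      unfolding A ord by (intro Sup_least) auto
    also have "\<dots> < ereal (real (i + 0))"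
      using that by simp
    finally show ?thesis .
  qed
  have "a (int n) l \<noteq> 0 \<longleftrightarrow> l = 0" for l
    using top [of l "int n"] n(1,2) by (cases "l = 0") (auto simp: a_def)
  then have "{ereal (real l) | l. \<exists>i. pure (a (int n)) l i \<noteq> 0} = {0}"
    by (auto simp: zero_ereal_def)
  then have symb: "Sdeg_A E p (z p) (symb P) = ereal (real 0)"
    by (simp add: symb_def ord A zero_ereal_def)
  have no_A: "\<not> contains_A E p (z p) (hcomp P t)" for t
    by (simp add: contains_A_iff [OF assms(1) form])
  show ?thesis
    unfolding condition_A0_without_A_def condition_A_def E_def [symmetric]
    using form free less symb no_A no_A [of "int_ord P", folded symb_def]
    unfolding Hcpc_def by blast
qed

lemma condition_imp_differential_operator:
  assumes "primitive_root p (z p)" "P \<in> Dsym F" "condition_A0_without_A F z p P"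
  shows "P \<in> D1 F \<and> has_constant_highest_symbol F P"
proof -
  define E where "E = adjoin F (z p)"
  have E: "is_subfield E"
    by (simp add: E_def is_subfield_adjoin)
  have Hcpc: "\<And>t. hcomp P t \<in> Hcpc E p (z p)"
    and free: "\<And>t. totally_free_of_B E p (z p) (hcomp P t)"
    and less: "\<And>i. i > 0 \<Longrightarrow> Sdeg_A E p (z p) (hcomp P (int_ord P - int i)) < ereal (real i)"
    and symb: "Sdeg_A E p (z p) (hcomp P (int_ord P)) = 0"
    and no_A: "\<And>t. \<not> contains_A E p (z p) (hcomp P t)"
    using assms(3)
    unfolding condition_A0_without_A_def condition_A_def E_def [symmetric] symb_def
    by (auto simp: zero_ereal_def)
  have "\<exists>a. hcp_form E p (z p) t (pure a) (\<lambda>_. 0) (hcomp P t)" for t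
  proof -
    obtain r f g where "hcp_form E p (z p) r f g (hcomp P t)"
      using Hcpc [of t] unfolding Hcpc_def by blast
    then have form: "hcp_form E p (z p) t f g (hcomp P t)"
      by (rule hcp_form_hcomp_degree [OF assms(1)])
    have "f l i = 0" if "i > 0" for l i
      using no_A [of t] that unfolding contains_A_iff [OF assms(1) form] by blast
    then have "f = pure (\<lambda>l. f l 0)"
      by (auto simp: pure_def fun_eq_iff)
    \<comment> \<open>The instance \<open>s = 0\<close> of total freedom removes the
      \<open>B_j\<close> from the component itself.\<close>
    moreover have "hcomp P t \<star> op_D 0 = hcomp P t"
      by (rule op_mult_D_0 [OF hcp_form_acts [OF form]])
    then have "Sdeg_B E p (z p) (hcomp P t) = - \<infinity>"
      using free [of t] unfolding totally_free_of_B_def by metis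
    then have "g = (\<lambda>_. 0)"
      by (auto simp: Sdeg_B_eq_MInfty_iff [OF assms(1) form])
    ultimately show ?thesis
      using form by metis
  qed
  then obtain a where form: "\<And>t. hcp_form E p (z p) t (pure (a t)) (\<lambda>_. 0) (hcomp P t)"
    by metis
  have low: "a t l = 0" if "int l < - t" for t l
    using coeff_eq_0_if_Sdeg_B_mult_D [OF assms(1) E form _ that] free
    unfolding totally_free_of_B_def by blast
  have hcomp: "hcomp P t = homogeneous_operator t (a t)" for t
  proof (rule acts_inject)
    show "acts (hcomp P t) t
        (\<lambda>m. hval p (z p) (pure (a t)) (\<lambda>_. 0) (nat (int m - t)) * ratio t m)"
      by (rule hcp_form_acts [OF form])
    show "acts (homogeneous_operator t (a t)) t
        (\<lambda>m. hval p (z p) (pure (a t)) (\<lambda>_. 0) (nat (int m - t)) * ratio t m)"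
      using assms(1) low by (intro acts_homogeneous_operator) (auto simp: primitive_root_def)
  qed
  have coeff: "fps_nth (P k) j = a (int k - int j) j" for k j
    by (subst hcomp_nth [symmetric]) (simp add: hcomp homogeneous_operator_def)
  note A = Sdeg_A_eq [OF assms(1) form]
  have upper: "ereal (real l) \<le> Sdeg_A E p (z p) (hcomp P t)" if "a t l \<noteq> 0" for t l
    unfolding A using that by (intro Sup_upper) auto
  have a_less: "l < i" if "i > 0" "a (int_ord P - int i) l \<noteq> 0" for i l
    using le_less_trans [OF upper [OF that(2)] less [OF that(1)]] by simp
  have a_top: "l = 0" if "a (int_ord P) l \<noteq> 0" for l
    using upper [OF that] by (simp add: symb zero_ereal_def)
  \<comment> \<open>The value 0 instead of \<open>-\<infinity>\<close> shows that the symbol has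
    some nonzero coefficient.\<close>
  have "Sup {ereal (real l) | l. \<exists>i. pure (a (int_ord P)) l i \<noteq> 0} \<noteq> - \<infinity>"
    using symb A [of "int_ord P"] by simp
  then have "\<exists>l. a (int_ord P) l \<noteq> 0"
    by (auto simp: Sup_eq_MInfty bot_ereal_def)
  then have a_0: "a (int_ord P) 0 \<noteq> 0"
    using a_top by metis
  \<comment> \<open>For a negative order, \<open>low\<close> would annihilate the coefficient at
    \<open>l = 0\<close>.\<close>
  then have "int_ord P \<ge> 0"
    using low [of 0 "int_ord P"] by force
  then obtain n where n: "int_ord P = int n"
    by (metis nonneg_int_cases)
  \<comment> \<open>With \<open>k - j = n - i\<close>, the bound \<open>j < i\<close> gives
    \<open>k < n\<close>; in the symbol, where \<open>i = 0\<close>, it gives \<open>j = 0\<close>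
    and \<open>k = n\<close>.\<close>
  have bound: "k < n \<or> k = n \<and> j = 0" if "fps_nth (P k) j \<noteq> 0" for k j
  proof -
    have "int k - int j \<le> int n"
      using int_ord_ge [of P k j] assms(2) that by (simp add: Dsym_def n)
    then obtain i where i: "int k - int j = int n - int i"
      by (metis add_diff_cancel_left' diff_add_cancel zle_iff_zadd)
    have nz: "a (int_ord P - int i) j \<noteq> 0"
      using that by (simp add: coeff i n)
    show ?thesis
    proof (cases "i = 0")
      case True
      then show ?thesis
        using i a_top [of j] nz by simp
    next
      case False
      then show ?thesis
        using i a_less [of i j] nz by simp
    qed
  qed
  have above: "P k = 0" if "k > n" for k
    using bound that by (fastforce intro: fps_ext)
  have top: "P n = fps_const (fps_nth (P n) 0)"
    using bound by (fastforce intro: fps_ext)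
  have "fps_nth (P n) 0 \<noteq> 0"
    using a_0 by (simp add: coeff n)
  \<comment> \<open>The leading constant is a coefficient of \<open>P\<close>, so it lies in
    \<open>F\<close> and not merely in \<open>E\<close>.\<close>
  moreover have "fps_nth (P n) 0 \<in> F"
    using assms(2) by (simp add: Dsym_def op_over_def)
  ultimately have "has_constant_highest_symbol F P"
    unfolding has_constant_highest_symbol_def using top above by blast
  moreover have "{k. P k \<noteq> 0} \<subseteq> {..n}"
    using above by (auto simp: not_less [symmetric])
  then have "P \<in> D1 F"
    using assms(2) by (auto simp: D1_def Dsym_def intro: finite_subset)
  ultimately show ?thesis
    by blast
qed

theorem theorem2p2:
  fixes K Kt :: "'a::field_char_0 set" and \<xi> :: "nat \<Rightarrow> 'a" and P :: "'a operator"
  assumes "is_subfield K" and "is_subfield Kt" and "K \<subseteq> Kt"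
    and "\<forall>q>1. primitive_root q (\<xi> q)"
    and "P \<in> Dsym Kt" and "P \<noteq> 0"
  shows "((P \<in> D1 Kt \<and> has_constant_highest_symbol Kt P) \<longleftrightarrow>
            (\<forall>p>1. condition_A0_without_A Kt \<xi> p P))
       \<and> ((\<forall>p>1. condition_A0_without_A Kt \<xi> p P) \<longleftrightarrow>
            (\<exists>p>1. condition_A0_without_A Kt \<xi> p P))"
proof -
  have "condition_A0_without_A Kt \<xi> p P"
    if "p > 1" "has_constant_highest_symbol Kt P" for p
    using assms that by (intro differential_operator_imp_condition) (auto simp: Dsym_def)
  moreover have "P \<in> D1 Kt \<and> has_constant_highest_symbol Kt P"
    if "p > 1" "condition_A0_without_A Kt \<xi> p P" for p
    using assms that condition_imp_differential_operator by blast
  \<comment> \<open>The instance \<open>p = 2\<close> leads from all \<open>p > 1\<close> to some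
    \<open>p > 1\<close>.\<close>
  moreover have "(1 :: nat) < 2"
    by simp
  ultimately show ?thesis
    by blast
qed

end
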